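(* There exists a divergence-free vector field $b\in C^\infty(\mathbb R^2;\mathbb R^2)$ with all derivatives bounded, having a stream function $H$ that satisfies $|H(x)|\le C\ln|x|\,\ln\ln|x|$ for some constant $C$ and all large enough $|x|$, such that the equation $-\Delta u+b\cdot\nabla u=0$ in $\mathbb R^2$ has a non-constant bounded classical solution $u$.
   Context: A stream function of a divergence-free vector field $b$ on $\mathbb R^2$ is a function $H:\mathbb R^2\to\mathbb R$ with $b=\nabla^\perp H=(H_{x_2},-H_{x_1})$. *)

theory Defs
  imports "HOL-Analysis.Analysis"
begin

text \<open>
  \<^term>\<open>frechet_derivative\<close> is unspecified where its argument is not differentiable, so
  \<open>partial\<close> is meaningful only together with a differentiability hypothesis.  The operators below are
  intended for functions that are differentiable to the required order.
\<close>

definition partial :: "'n \<Rightarrow> (real^'n \<Rightarrow> 'b::real_normed_vector) \<Rightarrow> real^'n \<Rightarrow> 'b" where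
  "partial i f x = frechet_derivative f (at x) (axis i 1)"

fun C_diff :: "nat \<Rightarrow> (real^'n \<Rightarrow> 'b::real_normed_vector) \<Rightarrow> bool" where
  "C_diff 0 f \<longleftrightarrow> continuous_on UNIV f"
| "C_diff (Suc k) f \<longleftrightarrow> (\<forall>x. f differentiable (at x)) \<and> (\<forall>i. C_diff k (partial i f))"

definition smooth :: "(real^'n \<Rightarrow> 'b::real_normed_vector) \<Rightarrow> bool" where
  "smooth f \<longleftrightarrow> (\<forall>k. C_diff k f)"

text \<open>
  A list of indices plays the role of a multi-index.  The empty list stands for the
  derivative of order zero, so \<open>f\<close> itself is required to be bounded.
\<close>

definition all_derivs_bounded :: "(real^'n \<Rightarrow> 'b::real_normed_vector) \<Rightarrow> bool" where
  "all_derivs_bounded f \<longleftrightarrow> (\<forall>is. bounded (range (foldr partial is f)))"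

definition grad :: "(real^'n \<Rightarrow> real) \<Rightarrow> real^'n \<Rightarrow> real^'n" where
  "grad f x = (\<chi> i. partial i f x)"

definition perp_grad :: "(real^2 \<Rightarrow> real) \<Rightarrow> real^2 \<Rightarrow> real^2" where
  "perp_grad f x = vector [partial 2 f x, - partial 1 f x]"

definition divergence :: "(real^'n \<Rightarrow> real^'n) \<Rightarrow> real^'n \<Rightarrow> real" where
  "divergence b x = (\<Sum>i\<in>UNIV. partial i (\<lambda>y. b y $ i) x)"

definition laplacian :: "(real^'n \<Rightarrow> real) \<Rightarrow> real^'n \<Rightarrow> real" where
  "laplacian f x = (\<Sum>i\<in>UNIV. partial i (partial i f) x)"

definition stream_function :: "(real^2 \<Rightarrow> real) \<Rightarrow> (real^2 \<Rightarrow> real^2) \<Rightarrow> bool" where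
  "stream_function H b \<longleftrightarrow> (\<forall>x. H differentiable (at x) \<and> b x = perp_grad H x)"

definition classical_solution :: "(real^'n \<Rightarrow> real^'n) \<Rightarrow> (real^'n \<Rightarrow> real) \<Rightarrow> bool" where
  "classical_solution b u \<longleftrightarrow> C_diff 2 u \<and> (\<forall>x. - laplacian u x + b x \<bullet> grad u x = 0)"

end

theory Submission
  imports Defs
begin

text \<open>
  For any function \<open>u\<close> without critical points, \<open>\<Delta>u = b \<bullet> \<nabla>u\<close> prescribes the derivative of
  \<open>H\<close> along the level curves of \<open>u\<close>, so one may choose \<open>u\<close> first and integrate.  Take
  \<open>u = g(X)\<close> with \<open>g\<close> an error function and \<open>(X, Y)\<close> the radial rescaling of the plane with
  \<open>X\<^sup>2 + Y\<^sup>2 = K\<close> and \<open>|x|\<^sup>2 = K exp (e\<^sup>K - 1)\<close>: the level curves are then the vertical lines of the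
  \<open>(X, Y)\<close>-plane, and \<open>K\<close> grows like \<open>ln ln |x|\<close>.  Integrating from the axis \<open>Y = 0\<close> gives
  \<open>H = X Y (M - e\<^sup>K)\<close> with \<open>M\<close> the mean of an elementary function over the vertical segment from \<open>(X, 0)\<close> to
  \<open>(X, Y)\<close> and \<open>M = O(e\<^sup>K)\<close>.  Hence \<open>|H| \<le> C K e\<^sup>K\<close>, which is of order \<open>ln |x| ln ln |x|\<close>.
  The derivatives of \<open>H\<close> are at most exponential in \<open>K\<close> times the factor \<open>X/x = exp (- (e\<^sup>K - 1) / 2)\<close>,
  which is doubly exponentially small.
\<close>

section \<open>Partial derivatives in the plane\<close>

text \<open>The total derivative is required, with the two partials as coefficients. This carries
  differentiability along with the values and so gives \<open>partial\<close> its intended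
  meaning.\<close>

definition has_partials :: "(real^2 \<Rightarrow> real) \<Rightarrow> (real^2 \<Rightarrow> real) \<Rightarrow> (real^2 \<Rightarrow> real) \<Rightarrow> bool" where
  "has_partials f f1 f2 \<longleftrightarrow> (\<forall>x. (f has_derivative (\<lambda>h. f1 x * h$1 + f2 x * h$2)) (at x))"

lemma has_partials_imp_differentiable: "has_partials f f1 f2 \<Longrightarrow> f differentiable (at x)"
  unfolding has_partials_def differentiable_def by blast

lemma has_partials_imp_continuous: "has_partials f f1 f2 \<Longrightarrow> continuous_on UNIV f"
  by (meson has_partials_imp_differentiable differentiable_imp_continuous_within continuous_at_imp_continuous_on)

lemma has_partials_partial:
  assumes "has_partials f f1 f2"
  shows "partial 1 f = f1" "partial 2 f = f2"
proof -
  have "frechet_derivative f (at x) = (\<lambda>h. f1 x * h$1 + f2 x * h$2)" for x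
    using frechet_derivative_at[OF assms[unfolded has_partials_def, rule_format, of x]] by simp
  then show "partial 1 f = f1" "partial 2 f = f2"
    by (simp_all add: partial_def axis_def fun_eq_iff)
qed

lemma has_partials_const: "has_partials (\<lambda>x. c) (\<lambda>x. 0) (\<lambda>x. 0)"
  by (simp add: has_partials_def)

lemma has_partials_nth:
  "has_partials (\<lambda>x. x$1) (\<lambda>x. 1) (\<lambda>x. 0)"
  "has_partials (\<lambda>x. x$2) (\<lambda>x. 0) (\<lambda>x. 1)"
  unfolding has_partials_def by (simp_all add: bounded_linear_imp_has_derivative bounded_linear_vec_nth)

lemma has_partials_add:
  assumes "has_partials f f1 f2" "has_partials g g1 g2"
  shows "has_partials (\<lambda>x. f x + g x) (\<lambda>x. f1 x + g1 x) (\<lambda>x. f2 x + g2 x)"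
  using assms unfolding has_partials_def
  by (auto intro!: derivative_eq_intros simp: algebra_simps)

lemma has_partials_mult:
  assumes "has_partials f f1 f2" "has_partials g g1 g2"
  shows "has_partials (\<lambda>x. f x * g x) (\<lambda>x. f1 x * g x + f x * g1 x) (\<lambda>x. f2 x * g x + f x * g2 x)"
  unfolding has_partials_def
proof
  fix x
  show "((\<lambda>x. f x * g x) has_derivative
         (\<lambda>h. (f1 x * g x + f x * g1 x) * h$1 + (f2 x * g x + f x * g2 x) * h$2)) (at x)"
    using has_derivative_mult[OF assms[unfolded has_partials_def, rule_format, of x]]
    by (rule has_derivative_eq_rhs) (auto simp: algebra_simps)
qed

lemma has_partials_compose:
  assumes "has_partials f f1 f2" "\<And>x. (\<phi> has_real_derivative \<phi>' x) (at x)"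
  shows "has_partials (\<lambda>x. \<phi> (f x)) (\<lambda>x. \<phi>' (f x) * f1 x) (\<lambda>x. \<phi>' (f x) * f2 x)"
  unfolding has_partials_def
proof
  fix x
  show "((\<lambda>x. \<phi> (f x)) has_derivative
         (\<lambda>h. \<phi>' (f x) * f1 x * h$1 + \<phi>' (f x) * f2 x * h$2)) (at x)"
    using has_derivative_compose[OF assms(1)[unfolded has_partials_def, rule_format, of x]
        assms(2)[of "f x", unfolded has_field_derivative_def]]
    by (rule has_derivative_eq_rhs) (auto simp: algebra_simps)
qed

text \<open>Brings the partials that the product and chain rules produce into a chosen form by
  pointwise algebra.\<close>

lemma has_partials_cong:
  assumes "has_partials f f1 f2" "\<And>x. f x = g x" "\<And>x. f1 x = g1 x" "\<And>x. f2 x = g2 x"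
  shows "has_partials g g1 g2"
proof -
  have "f = g" "f1 = g1" "f2 = g2" using assms by auto
  then show ?thesis using assms by simp
qed

text \<open>One function \<open>f12\<close> serves as both mixed partials. Symmetry is thus an
  invariant preserved by sums, products and compositions; its purpose is that the perpendicular
  gradient is divergence-free.\<close>

definition has_symmetric_partials :: "(real^2 \<Rightarrow> real) \<Rightarrow> bool" where
  "has_symmetric_partials f \<longleftrightarrow> (\<exists>f1 f2 f11 f12 f22.
     has_partials f f1 f2 \<and> has_partials f1 f11 f12 \<and> has_partials f2 f12 f22)"

lemma has_symmetric_partialsI:
  assumes "has_partials f f1 f2" "has_partials f1 f11 f12" "has_partials f2 f21 f22"
    "\<And>x. f12 x = f21 x"
  shows "has_symmetric_partials f"
proof -
  have "has_partials f2 f12 f22"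
    using has_partials_cong[OF assms(3)] assms(4) by simp
  then show ?thesis
    unfolding has_symmetric_partials_def using assms(1,2) by blast
qed

lemma has_symmetric_partials_const: "has_symmetric_partials (\<lambda>x. c)"
  by (rule has_symmetric_partialsI has_partials_const refl)+

lemma has_symmetric_partials_nth: "has_symmetric_partials (\<lambda>x. x$i)"
proof -
  have "has_symmetric_partials (\<lambda>x. x$1)" "has_symmetric_partials (\<lambda>x. x$2)"
    by (rule has_symmetric_partialsI has_partials_nth has_partials_const refl)+
  then show ?thesis using exhaust_2[of i] by auto
qed

lemma has_symmetric_partials_add:
  assumes "has_symmetric_partials f" "has_symmetric_partials g"
  shows "has_symmetric_partials (\<lambda>x. f x + g x)"
proof -
  obtain f1 f2 f11 f12 f22 g1 g2 g11 g12 g22 where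
    *: "has_partials f f1 f2" "has_partials f1 f11 f12" "has_partials f2 f12 f22"
    "has_partials g g1 g2" "has_partials g1 g11 g12" "has_partials g2 g12 g22"
    using assms unfolding has_symmetric_partials_def by blast
  show ?thesis
    by (rule has_symmetric_partialsI has_partials_add * refl)+
qed

lemma has_symmetric_partials_mult:
  assumes "has_symmetric_partials f" "has_symmetric_partials g"
  shows "has_symmetric_partials (\<lambda>x. f x * g x)"
proof -
  obtain f1 f2 f11 f12 f22 g1 g2 g11 g12 g22 where
    *: "has_partials f f1 f2" "has_partials f1 f11 f12" "has_partials f2 f12 f22"
    "has_partials g g1 g2" "has_partials g1 g11 g12" "has_partials g2 g12 g22"
    using assms unfolding has_symmetric_partials_def by blast
  show ?thesis
    by (rule has_symmetric_partialsI, (rule has_partials_add has_partials_mult *)+) (simp add: algebra_simps)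
qed

lemma has_symmetric_partials_compose:
  assumes "has_symmetric_partials f"
    "\<And>x. (\<phi> has_real_derivative \<phi>' x) (at x)" "\<And>x. (\<phi>' has_real_derivative \<phi>'' x) (at x)"
  shows "has_symmetric_partials (\<lambda>x. \<phi> (f x))"
proof -
  obtain f1 f2 f11 f12 f22 where
    *: "has_partials f f1 f2" "has_partials f1 f11 f12" "has_partials f2 f12 f22"
    using assms unfolding has_symmetric_partials_def by blast
  show ?thesis
    by (rule has_symmetric_partialsI,
        (rule has_partials_compose[OF _ assms(2)] has_partials_compose[OF _ assms(3)] has_partials_mult *)+)
      (simp add: algebra_simps)
qed

section \<open>Means along vertical segments\<close>

text \<open>
  For \<open>n = 0\<close> the mean of \<open>\<phi>(X\<^sup>2 + Y\<^sup>2)\<close> over the segment from \<open>(a, 0)\<close> to \<open>(a, b)\<close>; the weight \<open>s ^ n\<close>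
  makes the family closed under differentiation in \<open>a\<close> and \<open>b\<close>.
\<close>

definition segment_mean :: "nat \<Rightarrow> (real \<Rightarrow> real) \<Rightarrow> real \<Rightarrow> real \<Rightarrow> real" where
  "segment_mean n \<phi> a b = integral {0..1} (\<lambda>s. s ^ n * \<phi> (a\<^sup>2 + s\<^sup>2 * b\<^sup>2))"

lemma segment_mean_integrable:
  assumes "continuous_on UNIV \<phi>"
  shows "(\<lambda>s::real. s ^ n * \<phi> (a\<^sup>2 + s\<^sup>2 * b\<^sup>2)) integrable_on {0..1}"
  by (rule integrable_continuous_interval)
    (auto intro!: continuous_intros continuous_on_compose2[OF assms])

text \<open>Differentiation under the integral sign. The derivative in b of \<phi>(a^2 + s^2 b^2)
  brings out a factor s^2, which raises the weight from n to n + 2.\<close>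

lemma segment_mean_has_derivative:
  assumes "\<And>x. (\<phi> has_real_derivative \<phi>' x) (at x)" "continuous_on UNIV \<phi>'"
  shows "((\<lambda>(a,b). segment_mean n \<phi> a b) has_derivative
    (\<lambda>(h,k). 2 * a * segment_mean n \<phi>' a b * h + 2 * b * segment_mean (n+2) \<phi>' a b * k)) (at (a,b))"
proof -
  define F where "F = (\<lambda>(p::real\<times>real) (s::real). s ^ n * \<phi> ((fst p)\<^sup>2 + s\<^sup>2 * (snd p)\<^sup>2))"
  \<comment> \<open>The derivative of the integrand as a bounded linear map, the form in which
    \<open>leibniz_rule\<close> takes it.\<close>
  define F' where "F' = (\<lambda>(p::real\<times>real) (s::real).
    (2 * fst p * (s ^ n * \<phi>' ((fst p)\<^sup>2 + s\<^sup>2 * (snd p)\<^sup>2))) *\<^sub>R (fst_blinfun :: (real\<times>real) \<Rightarrow>\<^sub>L real)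
    + (2 * snd p * (s ^ (n+2) * \<phi>' ((fst p)\<^sup>2 + s\<^sup>2 * (snd p)\<^sup>2))) *\<^sub>R snd_blinfun)"
  have c: "continuous_on UNIV \<phi>"
    using assms(1) by (auto simp: continuous_on_eq_continuous_at intro: DERIV_isCont)
  have d: "((\<lambda>p. F p s) has_derivative blinfun_apply (F' p s)) (at p)" for p s
  proof -
    have 1: "((\<lambda>p::real\<times>real. (fst p)\<^sup>2 + s\<^sup>2 * (snd p)\<^sup>2) has_derivative
        (\<lambda>h. 2 * fst p * fst h + s\<^sup>2 * (2 * snd p * snd h))) (at p)"
      by (auto intro!: derivative_eq_intros)
    note 2 = has_derivative_compose[OF 1 assms(1)[of "(fst p)\<^sup>2 + s\<^sup>2 * (snd p)\<^sup>2", unfolded has_field_derivative_def]]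
    show ?thesis
      unfolding F_def F'_def
      by (rule has_derivative_eq_rhs[OF has_derivative_mult_right[OF 2]])
        (auto simp: blinfun.bilinear_simps algebra_simps power2_eq_square)
  qed
  have cc: "continuous_on (UNIV \<times> cbox 0 1) (\<lambda>(p,s). F' p s)"
    unfolding F'_def split_beta
    by (auto intro!: continuous_intros continuous_on_compose2[OF assms(2)])
  have int: "F p integrable_on cbox 0 1" for p
    unfolding F_def using segment_mean_integrable[OF c] by simp
  have "((\<lambda>p. integral (cbox 0 1) (F p)) has_derivative blinfun_apply (integral (cbox 0 1) (F' (a,b)))) (at (a,b) within UNIV)"
    by (rule leibniz_rule[OF d int cc]) auto
  moreover have "(\<lambda>p. integral (cbox 0 1) (F p)) = (\<lambda>(a,b). segment_mean n \<phi> a b)"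
    unfolding F_def segment_mean_def by auto
  moreover have eq: "blinfun_apply (integral (cbox 0 1) (F' (a,b))) (h,k) =
      2 * a * segment_mean n \<phi>' a b * h + 2 * b * segment_mean (n+2) \<phi>' a b * k" for h k
  proof -
    have i: "F' (a,b) integrable_on cbox 0 1"
    proof (rule integrable_continuous)
      have "continuous_on (cbox 0 1) (\<lambda>s. (\<lambda>(p,s). F' p s) ((a,b),s))"
        by (rule continuous_on_compose2[OF cc]) (auto intro!: continuous_intros)
      then show "continuous_on (cbox 0 1) (F' (a,b))" by simp
    qed
    have "blinfun_apply (integral (cbox 0 1) (F' (a,b))) (h,k) = integral (cbox 0 1) (\<lambda>s. blinfun_apply (F' (a,b) s) (h,k))"
      using integral_linear[OF i, of "\<lambda>f. blinfun_apply f (h,k)"]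
      by (simp add: blinfun.bounded_linear_left o_def)
    also have "\<dots> = integral {0..1} (\<lambda>s. 2 * a * h * (s ^ n * \<phi>' (a\<^sup>2 + s\<^sup>2 * b\<^sup>2)) + 2 * b * k * (s ^ (n+2) * \<phi>' (a\<^sup>2 + s\<^sup>2 * b\<^sup>2)))"
      unfolding F'_def by (simp add: blinfun.bilinear_simps algebra_simps)
    also have "\<dots> = 2 * a * h * segment_mean n \<phi>' a b + 2 * b * k * segment_mean (n+2) \<phi>' a b"
      unfolding segment_mean_def
      by (intro integral_unique has_integral_add has_integral_mult_right integrable_integral
          segment_mean_integrable assms(2))
    finally show ?thesis by (simp add: algebra_simps)
  qed
  moreover have "blinfun_apply (integral (cbox 0 1) (F' (a,b))) =
      (\<lambda>(h,k). 2 * a * segment_mean n \<phi>' a b * h + 2 * b * segment_mean (n+2) \<phi>' a b * k)"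
    using eq by (simp add: fun_eq_iff)
  ultimately show ?thesis by simp
qed

lemma has_partials_segment_mean:
  assumes "\<And>x. (\<phi> has_real_derivative \<phi>' x) (at x)" "continuous_on UNIV \<phi>'"
    and "has_partials f f1 f2" "has_partials g g1 g2"
  shows "has_partials (\<lambda>x. segment_mean n \<phi> (f x) (g x))
    (\<lambda>x. 2 * f x * segment_mean n \<phi>' (f x) (g x) * f1 x + 2 * g x * segment_mean (n+2) \<phi>' (f x) (g x) * g1 x)
    (\<lambda>x. 2 * f x * segment_mean n \<phi>' (f x) (g x) * f2 x + 2 * g x * segment_mean (n+2) \<phi>' (f x) (g x) * g2 x)"
  unfolding has_partials_def
proof
  fix x
  have 1: "((\<lambda>x. (f x, g x)) has_derivative
      (\<lambda>h. (f1 x * h$1 + f2 x * h$2, g1 x * h$1 + g2 x * h$2))) (at x)"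
    using assms(3,4) unfolding has_partials_def by (intro has_derivative_Pair) auto
  show "((\<lambda>x. segment_mean n \<phi> (f x) (g x)) has_derivative
     (\<lambda>h. (2 * f x * segment_mean n \<phi>' (f x) (g x) * f1 x + 2 * g x * segment_mean (n+2) \<phi>' (f x) (g x) * g1 x) * h$1
        + (2 * f x * segment_mean n \<phi>' (f x) (g x) * f2 x + 2 * g x * segment_mean (n+2) \<phi>' (f x) (g x) * g2 x) * h$2)) (at x)"
    using has_derivative_eq_rhs[OF has_derivative_compose[OF 1
        segment_mean_has_derivative[OF assms(1,2), where a = "f x" and b = "g x" and n = n]]]
    by (simp add: algebra_simps)
qed

text \<open>The left side is the b-derivative of b times the mean, that is, of the integral of
  \<phi>(a^2 + y^2) over y from 0 to b. The proof integrates the s-derivative of s * \<phi>(a^2 +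
  s^2 b^2) over [0, 1].\<close>

lemma segment_mean_deriv_identity:
  assumes "\<And>x. (\<phi> has_real_derivative \<phi>' x) (at x)" "continuous_on UNIV \<phi>'"
  shows "segment_mean 0 \<phi> a b + 2 * b\<^sup>2 * segment_mean 2 \<phi>' a b = \<phi> (a\<^sup>2 + b\<^sup>2)"
proof -
  have c: "continuous_on UNIV \<phi>"
    using assms(1) by (auto simp: continuous_on_eq_continuous_at intro: DERIV_isCont)
  have "((\<lambda>s. s * \<phi> (a\<^sup>2 + s\<^sup>2 * b\<^sup>2)) has_real_derivative
      (\<phi> (a\<^sup>2 + s\<^sup>2 * b\<^sup>2) + 2 * b\<^sup>2 * (s\<^sup>2 * \<phi>' (a\<^sup>2 + s\<^sup>2 * b\<^sup>2)))) (at s within {0..1})" for s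
    by (rule derivative_eq_intros DERIV_chain2[OF assms(1)] refl)+ (simp add: algebra_simps power2_eq_square)
  then have "((\<lambda>s. \<phi> (a\<^sup>2 + s\<^sup>2 * b\<^sup>2) + 2 * b\<^sup>2 * (s\<^sup>2 * \<phi>' (a\<^sup>2 + s\<^sup>2 * b\<^sup>2))) has_integral
      (1 * \<phi> (a\<^sup>2 + 1\<^sup>2 * b\<^sup>2) - 0 * \<phi> (a\<^sup>2 + 0\<^sup>2 * b\<^sup>2))) {0..1}"
    by (intro fundamental_theorem_of_calculus) (auto simp: has_real_derivative_iff_has_vector_derivative)
  then have "integral {0..1} (\<lambda>s. \<phi> (a\<^sup>2 + s\<^sup>2 * b\<^sup>2) + 2 * b\<^sup>2 * (s\<^sup>2 * \<phi>' (a\<^sup>2 + s\<^sup>2 * b\<^sup>2))) = \<phi> (a\<^sup>2 + b\<^sup>2)"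
    by (simp add: integral_unique)
  moreover have "integral {0..1} (\<lambda>s. \<phi> (a\<^sup>2 + s\<^sup>2 * b\<^sup>2) + 2 * b\<^sup>2 * (s\<^sup>2 * \<phi>' (a\<^sup>2 + s\<^sup>2 * b\<^sup>2)))
     = segment_mean 0 \<phi> a b + 2 * b\<^sup>2 * segment_mean 2 \<phi>' a b"
    unfolding segment_mean_def
    using segment_mean_integrable[OF c, of 0 a b] segment_mean_integrable[OF assms(2), of 2 a b]
    by (subst integral_add) (auto intro!: integrable_on_mult_right)
  ultimately show ?thesis by simp
qed

lemma segment_mean_bound:
  assumes "continuous_on UNIV \<phi>" "\<And>x. a\<^sup>2 \<le> x \<Longrightarrow> x \<le> a\<^sup>2 + b\<^sup>2 \<Longrightarrow> \<bar>\<phi> x\<bar> \<le> B"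
  shows "\<bar>segment_mean n \<phi> a b\<bar> \<le> B"
proof -
  have "norm (integral {0..1} (\<lambda>s::real. s ^ n * \<phi> (a\<^sup>2 + s\<^sup>2 * b\<^sup>2))) \<le> integral {0..1} (\<lambda>s::real. B)"
  proof (rule integral_norm_bound_integral[OF segment_mean_integrable[OF assms(1)]])
    fix s :: real assume s: "s \<in> {0..1}"
    have "s\<^sup>2 * b\<^sup>2 \<le> 1 * b\<^sup>2" using s by (intro mult_right_mono) (auto simp: power_le_one)
    then have *: "\<bar>\<phi> (a\<^sup>2 + s\<^sup>2 * b\<^sup>2)\<bar> \<le> B" by (intro assms(2)) auto
    have "\<bar>s ^ n\<bar> * \<bar>\<phi> (a\<^sup>2 + s\<^sup>2 * b\<^sup>2)\<bar> \<le> 1 * B"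
      using s * by (intro mult_mono) (auto simp: power_le_one)
    then show "norm (s ^ n * \<phi> (a\<^sup>2 + s\<^sup>2 * b\<^sup>2)) \<le> B" by (simp add: abs_mult)
  qed auto
  then show ?thesis by (simp add: segment_mean_def)
qed

lemma has_symmetric_partials_segment_mean:
  assumes "\<And>x. (\<phi> has_real_derivative \<phi>' x) (at x)" "\<And>x. (\<phi>' has_real_derivative \<phi>'' x) (at x)"
    and "continuous_on UNIV \<phi>''"
    and "has_symmetric_partials f" "has_symmetric_partials g"
  shows "has_symmetric_partials (\<lambda>x. segment_mean n \<phi> (f x) (g x))"
proof -
  obtain f1 f2 f11 f12 f22 g1 g2 g11 g12 g22 where
    *: "has_partials f f1 f2" "has_partials f1 f11 f12" "has_partials f2 f12 f22"
    "has_partials g g1 g2" "has_partials g1 g11 g12" "has_partials g2 g12 g22"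
    using assms unfolding has_symmetric_partials_def by blast
  have c: "continuous_on UNIV \<phi>'"
    using assms(2) by (auto simp: continuous_on_eq_continuous_at intro: DERIV_isCont)
  show ?thesis
    by (rule has_symmetric_partialsI,
        (rule has_partials_segment_mean[OF assms(1) c] has_partials_segment_mean[OF assms(2,3)]
          has_partials_const has_partials_add has_partials_mult *)+)
      (simp add: algebra_simps)
qed

section \<open>Functions of exponential growth\<close>

text \<open>The factor 1 + k e^k comes from the derivative of \<open>stretch\<close>, so its
  reciprocal appears in every derivative of the inverse \<open>squeeze\<close>.\<close>

definition recip :: "real \<Rightarrow> real" where
  "recip k = 1 / (1 + k * exp k)"

text \<open>For negative k this is -k < e^(-k). Positivity on the whole line makes
  \<open>recip\<close> smooth everywhere and keeps the calculus free of domain conditions.\<close>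

lemma recip_denom_pos: "0 < 1 + k * exp k" for k :: real
proof (cases "k \<ge> 0")
  case False
  have "- k < exp (- k)"
    using exp_ge_add_one_self[of "- k"] by linarith
  then have "- k * exp k < exp (- k) * exp k"
    by (intro mult_strict_right_mono) auto
  then show ?thesis
    by (simp flip: exp_add)
qed (simp add: add_pos_nonneg)

lemma recip_eq: "recip k * (1 + k * exp k) = 1"
  using recip_denom_pos[of k] by (simp add: recip_def)

lemma recip_pos: "0 < recip k"
  using recip_denom_pos[of k] by (simp add: recip_def)

lemma recip_le_1: "0 \<le> k \<Longrightarrow> recip k \<le> 1"
  using recip_denom_pos[of k] by (simp add: recip_def field_simps)

lemma recip_DERIV: "(recip has_real_derivative - (1 + k) * exp k * (recip k * recip k)) (at k)"
  unfolding recip_def using recip_denom_pos[of k]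
  by (auto intro!: derivative_eq_intros simp: field_simps)

text \<open>The rate \<kappa> is a parameter so that the same closure rules serve \<open>abs\<close>
  on the line and \<open>radial\<close> in the plane.\<close>

definition exp_dominated :: "('a \<Rightarrow> real) \<Rightarrow> ('a \<Rightarrow> real) \<Rightarrow> bool" where
  "exp_dominated \<kappa> f \<longleftrightarrow> (\<exists>C n. \<forall>x. \<bar>f x\<bar> \<le> C * exp (real n * \<kappa> x))"

lemma exp_dominatedI: "(\<And>x. \<bar>f x\<bar> \<le> C * exp (real n * \<kappa> x)) \<Longrightarrow> exp_dominated \<kappa> f"
  unfolding exp_dominated_def by blast

lemma exp_dominated_const: "exp_dominated \<kappa> (\<lambda>x. c)"
  by (rule exp_dominatedI[of _ "\<bar>c\<bar>" 0]) simp

lemma exp_dominated_add: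
  assumes "exp_dominated \<kappa> f" "exp_dominated \<kappa> g" and nonneg: "\<And>x. 0 \<le> \<kappa> x"
  shows "exp_dominated \<kappa> (\<lambda>x. f x + g x)"
proof -
  obtain C m D n where f: "\<And>x. \<bar>f x\<bar> \<le> C * exp (real m * \<kappa> x)"
    and g: "\<And>x. \<bar>g x\<bar> \<le> D * exp (real n * \<kappa> x)"
    using assms unfolding exp_dominated_def by blast
  show ?thesis
  proof (rule exp_dominatedI)
    fix x
    have "C * exp (real m * \<kappa> x) \<le> \<bar>C\<bar> * exp (real (m + n) * \<kappa> x)"
      using nonneg[of x] by (intro mult_mono) (auto simp: mult_right_mono)
    moreover have "D * exp (real n * \<kappa> x) \<le> \<bar>D\<bar> * exp (real (m + n) * \<kappa> x)"
      using nonneg[of x] by (intro mult_mono) (auto simp: mult_right_mono)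
    ultimately show "\<bar>f x + g x\<bar> \<le> (\<bar>C\<bar> + \<bar>D\<bar>) * exp (real (m + n) * \<kappa> x)"
      using f[of x] g[of x] abs_triangle_ineq[of "f x" "g x"]
      by (simp only: distrib_right)
  qed
qed

lemma exp_dominated_mult:
  assumes "exp_dominated \<kappa> f" "exp_dominated \<kappa> g"
  shows "exp_dominated \<kappa> (\<lambda>x. f x * g x)"
proof -
  obtain C m D n where f: "\<And>x. \<bar>f x\<bar> \<le> C * exp (real m * \<kappa> x)"
    and g: "\<And>x. \<bar>g x\<bar> \<le> D * exp (real n * \<kappa> x)"
    using assms unfolding exp_dominated_def by blast
  show ?thesis
  proof (rule exp_dominatedI)
    fix x
    have "\<bar>f x\<bar> * \<bar>g x\<bar> \<le> (C * exp (real m * \<kappa> x)) * (D * exp (real n * \<kappa> x))"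
      using f[of x] g[of x] by (intro mult_mono) (auto intro: order_trans[OF abs_ge_zero])
    then show "\<bar>f x * g x\<bar> \<le> (C * D) * exp (real (m + n) * \<kappa> x)"
      by (simp add: abs_mult exp_add distrib_right algebra_simps)
  qed
qed

text \<open>A ring of functions of K that contains the drift cores and is stable under
  differentiation, since the derivative of \<open>recip\<close> is a polynomial in k, e^k and
  \<open>recip\<close> itself.\<close>

inductive_set exp_ring :: "(real \<Rightarrow> real) set" where
  const: "(\<lambda>k. c) \<in> exp_ring"
| ident: "(\<lambda>k. k) \<in> exp_ring"
| exp: "(\<lambda>k. exp k) \<in> exp_ring"
| recip: "(\<lambda>k. recip k) \<in> exp_ring"
| add: "\<phi> \<in> exp_ring \<Longrightarrow> \<psi> \<in> exp_ring \<Longrightarrow> (\<lambda>k. \<phi> k + \<psi> k) \<in> exp_ring"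
| mult: "\<phi> \<in> exp_ring \<Longrightarrow> \<psi> \<in> exp_ring \<Longrightarrow> (\<lambda>k. \<phi> k * \<psi> k) \<in> exp_ring"

lemma exp_ring_DERIV:
  "\<phi> \<in> exp_ring \<Longrightarrow> \<exists>\<phi>'\<in>exp_ring. \<forall>k. (\<phi> has_real_derivative \<phi>' k) (at k)"
proof (induction rule: exp_ring.induct)
  case (const c)
  show ?case by (rule bexI[OF _ exp_ring.const[of 0]]) simp
next
  case ident
  show ?case by (rule bexI[OF _ exp_ring.const[of 1]]) simp
next
  case exp
  show ?case by (rule bexI[OF _ exp_ring.exp]) (simp add: DERIV_exp)
next
  case recip
  have "(\<lambda>k. (- 1 + (- 1) * k) * exp k * (recip k * recip k)) \<in> exp_ring"
    by (intro exp_ring.intros)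
  then show ?case
    by (rule bexI[rotated]) (use recip_DERIV in \<open>auto simp: algebra_simps\<close>)
next
  case (add \<phi> \<psi>)
  then obtain \<phi>' \<psi>' where *: "\<phi>' \<in> exp_ring" "\<psi>' \<in> exp_ring"
    "\<And>k. (\<phi> has_real_derivative \<phi>' k) (at k)" "\<And>k. (\<psi> has_real_derivative \<psi>' k) (at k)"
    by blast
  show ?case
    by (rule bexI[OF _ exp_ring.add[OF *(1,2)]]) (auto intro!: DERIV_add *)
next
  case (mult \<phi> \<psi>)
  then obtain \<phi>' \<psi>' where *: "\<phi>' \<in> exp_ring" "\<psi>' \<in> exp_ring"
    "\<And>k. (\<phi> has_real_derivative \<phi>' k) (at k)" "\<And>k. (\<psi> has_real_derivative \<psi>' k) (at k)"
    by blast
  show ?case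
    by (rule bexI[OF _ exp_ring.add[OF exp_ring.mult[OF *(1) mult.hyps(2)] exp_ring.mult[OF *(2) mult.hyps(1)]]])
      (auto intro!: DERIV_mult *)
qed

lemma exp_ring_continuous: "\<phi> \<in> exp_ring \<Longrightarrow> continuous_on UNIV \<phi>"
  using exp_ring_DERIV[of \<phi>] by (auto simp: continuous_on_eq_continuous_at intro: DERIV_isCont)

text \<open>Composition with the absolute value restricts the claim to k \<ge> 0, the range of
  \<open>radial\<close>, where \<open>recip\<close> is at most 1.\<close>

lemma exp_ring_dominated: "\<phi> \<in> exp_ring \<Longrightarrow> exp_dominated abs (\<lambda>k. \<phi> \<bar>k\<bar>)"
proof (induction rule: exp_ring.induct)
  case ident
  show ?case
  proof (rule exp_dominatedI[of _ 1 1])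
    show "\<bar>\<bar>x\<bar>\<bar> \<le> 1 * exp (real 1 * \<bar>x\<bar>)" for x :: real
      using order_trans[OF _ exp_ge_add_one_self[of "\<bar>x\<bar>"]] by simp
  qed
next
  case exp
  show ?case by (rule exp_dominatedI[of _ 1 1]) simp
next
  case recip
  show ?case
    using recip_pos recip_le_1 by (intro exp_dominatedI[of _ 1 0]) (simp add: abs_of_pos)
qed (auto intro: exp_dominated_const exp_dominated_add exp_dominated_mult)

section \<open>The radial rescaling\<close>

definition stretch :: "real \<Rightarrow> real" where
  "stretch k = k * exp (exp k - 1)"

lemma stretch_DERIV:
  "(stretch has_real_derivative exp (exp k - 1) * (1 + k * exp k)) (at k)"
  unfolding stretch_def by (auto intro!: derivative_eq_intros simp: algebra_simps)

lemma stretch_strict_mono: "strict_mono stretch"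
proof (rule strict_monoI)
  fix a b :: real assume "a < b"
  then show "stretch a < stretch b"
    by (rule DERIV_pos_imp_increasing)
      (intro exI conjI, rule stretch_DERIV, simp add: recip_denom_pos)
qed

lemma stretch_ge: "0 \<le> k \<Longrightarrow> k \<le> stretch k"
  by (simp add: stretch_def mult_le_cancel_left1)

lemma stretch_le: "k \<le> 0 \<Longrightarrow> stretch k \<le> k * exp (- 1)"
  by (simp add: stretch_def mult_left_mono_neg)

lemma stretch_isCont: "isCont stretch k"
  using stretch_DERIV by (rule DERIV_isCont)

lemma stretch_surj: "surj stretch"
proof (rule surjI)
  fix y :: real
  \<comment> \<open>Bracketing points for the intermediate value theorem: \<open>stretch k\<close>
    is at most k/e for k \<le> 0 and at least k for k \<ge> 0.\<close>
  define a b where "a = - \<bar>y\<bar> * exp 1" and "b = \<bar>y\<bar>"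
  have "stretch a \<le> y"
    using stretch_le[of a] by (simp add: a_def exp_minus mult.assoc)
  moreover have "y \<le> stretch b"
    using stretch_ge[of b] by (auto simp: b_def)
  moreover have "a \<le> b"
    unfolding a_def b_def by (rule order_trans[of _ 0]) auto
  ultimately have "\<exists>k. stretch k = y"
    using IVT[of stretch a y b] stretch_isCont by blast
  then show "stretch (SOME k. stretch k = y) = y"
    by (rule someI_ex)
qed

text \<open>The inverse is taken on the whole line, so it is differentiable at 0 as well; this makes
  \<open>radial\<close> smooth at the origin of the plane.\<close>

definition squeeze :: "real \<Rightarrow> real" where
  "squeeze = inv stretch"

lemma stretch_squeeze [simp]: "stretch (squeeze r) = r"
  by (simp add: squeeze_def surj_f_inv_f stretch_surj)

lemma squeeze_stretch [simp]: "squeeze (stretch k) = k"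
  by (simp add: squeeze_def inv_f_f strict_mono_imp_inj_on[OF stretch_strict_mono])

lemma squeeze_mono: "a \<le> b \<Longrightarrow> squeeze a \<le> squeeze b"
  using strict_mono_less_eq[OF stretch_strict_mono, of "squeeze a" "squeeze b"] by simp

lemma squeeze_0 [simp]: "squeeze 0 = 0"
  using squeeze_stretch[of 0] by (simp add: stretch_def)

lemma squeeze_isCont: "isCont squeeze r"
  using isCont_inverse_function[of 1 "squeeze r" squeeze stretch] stretch_isCont by simp

lemma squeeze_DERIV:
  "(squeeze has_real_derivative exp (- (exp (squeeze r) - 1)) * recip (squeeze r)) (at r)"
proof -
  have "(squeeze has_real_derivative
      inverse (exp (exp (squeeze r) - 1) * (1 + squeeze r * exp (squeeze r)))) (at r)"
    by (rule DERIV_inverse_function[OF stretch_DERIV, of _ _ "r - 1" "r + 1"])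
      (use recip_denom_pos[of "squeeze r"] in \<open>auto simp: squeeze_isCont\<close>)
  then show ?thesis
    by (simp add: recip_def exp_minus[symmetric] divide_inverse)
qed

section \<open>The rescaled coordinates X, Y and their gradients\<close>

definition radial :: "real^2 \<Rightarrow> real" where
  "radial x = squeeze ((x$1)\<^sup>2 + (x$2)\<^sup>2)"

text \<open>The common ratio X/x = Y/y, written without a division so that it makes sense at the
  origin. Its square is K/|x|^2 away from the origin.\<close>

definition damping :: "real^2 \<Rightarrow> real" where
  "damping x = exp (- (exp (radial x) - 1) / 2)"

definition cx :: "real^2 \<Rightarrow> real" where "cx x = x$1 * damping x"
definition cy :: "real^2 \<Rightarrow> real" where "cy x = x$2 * damping x"

lemma radial_nonneg: "0 \<le> radial x"
  unfolding radial_def using squeeze_mono[of 0 "(x$1)\<^sup>2 + (x$2)\<^sup>2"] by simp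

lemma damping_pos: "0 < damping x"
  by (simp add: damping_def)

lemma damping_square: "damping x * damping x = exp (- (exp (radial x) - 1))"
  unfolding damping_def by (simp flip: exp_add)

lemma radial_eq: "(cx x)\<^sup>2 + (cy x)\<^sup>2 = radial x"
proof -
  have "(cx x)\<^sup>2 + (cy x)\<^sup>2 = ((x$1)\<^sup>2 + (x$2)\<^sup>2) * (damping x * damping x)"
    by (simp add: cx_def cy_def algebra_simps power2_eq_square)
  also have "\<dots> = stretch (radial x) * exp (- (exp (radial x) - 1))"
    by (simp add: damping_square) (simp add: radial_def)
  also have "\<dots> = radial x"
    by (simp add: stretch_def flip: exp_add)
  finally show ?thesis .
qed

text \<open>The coefficient Q in the gradient of \<open>damping\<close>: the gradient of ln
  \<open>damping\<close> is -Q \<open>damping\<close> (X, Y).\<close>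

definition q :: "real^2 \<Rightarrow> real" where
  "q x = exp (radial x) * recip (radial x)"

text \<open>The derivative of \<open>squeeze\<close> supplies \<open>damping\<close> squared. One of
  the two factors turns the coordinate x into \<open>cx x\<close>, and the other remains in
  front.\<close>

lemma has_partials_radial:
  "has_partials radial (\<lambda>x. damping x * (2 * cx x * recip (radial x)))
     (\<lambda>x. damping x * (2 * cy x * recip (radial x)))"
proof -
  have "has_partials (\<lambda>x. squeeze (x$1 * x$1 + x$2 * x$2))
     (\<lambda>x. exp (- (exp (squeeze (x$1 * x$1 + x$2 * x$2)) - 1)) * recip (squeeze (x$1 * x$1 + x$2 * x$2)) * ((1 * x$1 + x$1 * 1) + (0 * x$2 + x$2 * 0)))
     (\<lambda>x. exp (- (exp (squeeze (x$1 * x$1 + x$2 * x$2)) - 1)) * recip (squeeze (x$1 * x$1 + x$2 * x$2)) * ((0 * x$1 + x$1 * 0) + (1 * x$2 + x$2 * 1)))"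
    by (rule has_partials_compose[OF _ squeeze_DERIV] has_partials_add has_partials_mult has_partials_nth)+
  then show ?thesis
    by (rule has_partials_cong)
      (simp_all only: radial_def[symmetric] power2_eq_square[symmetric] damping_square[symmetric],
        simp_all add: radial_def cx_def cy_def power2_eq_square algebra_simps)
qed

text \<open>Signs are written as products with \<open>- 1\<close>, so that the cofactor of
  \<open>damping\<close> is literally built from sums and products and its membership in
  \<open>plane_ring\<close> follows from the introduction rules.\<close>

lemma has_partials_damping:
  "has_partials damping (\<lambda>x. damping x * (- 1 * cx x * damping x * q x)) (\<lambda>x. damping x * (- 1 * cy x * damping x * q x))"
proof -
  have "((\<lambda>k::real. exp (- (exp k - 1) / 2)) has_real_derivative exp (- (exp k - 1) / 2) * (- exp k / 2)) (at k)" for k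
    by (auto intro!: derivative_eq_intros)
  from has_partials_compose[OF has_partials_radial this]
  show ?thesis
    by (rule has_partials_cong) (simp_all add: damping_def q_def)
qed

lemma has_partials_cx:
  "has_partials cx (\<lambda>x. damping x * (1 + - 1 * cx x * cx x * q x)) (\<lambda>x. damping x * (- 1 * cx x * cy x * q x))"
  using has_partials_mult[OF has_partials_nth(1) has_partials_damping]
  by (rule has_partials_cong) (auto simp: cx_def cy_def algebra_simps)

lemma has_partials_cy:
  "has_partials cy (\<lambda>x. damping x * (- 1 * cx x * cy x * q x)) (\<lambda>x. damping x * (1 + - 1 * cy x * cy x * q x))"
  using has_partials_mult[OF has_partials_nth(2) has_partials_damping]
  by (rule has_partials_cong) (auto simp: cx_def cy_def algebra_simps)

section \<open>A ring of functions stable under differentiation\<close>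

text \<open>
  Partial derivatives map \<open>plane_ring\<close> into \<open>damping \<cdot> plane_ring\<close>, and \<open>damping\<close> beats the at most
  exponential growth in \<open>radial\<close> of the elements of the ring.
\<close>

inductive_set plane_ring :: "(real^2 \<Rightarrow> real) set" where
  cx: "(\<lambda>x. cx x) \<in> plane_ring"
| cy: "(\<lambda>x. cy x) \<in> plane_ring"
| damping: "(\<lambda>x. damping x) \<in> plane_ring"
| gauss: "(\<lambda>x. exp (- (cx x)\<^sup>2)) \<in> plane_ring"
| radial: "\<phi> \<in> exp_ring \<Longrightarrow> (\<lambda>x. \<phi> (radial x)) \<in> plane_ring"
| mean: "\<phi> \<in> exp_ring \<Longrightarrow> (\<lambda>x. segment_mean n \<phi> (cx x) (cy x)) \<in> plane_ring"
| add: "f \<in> plane_ring \<Longrightarrow> g \<in> plane_ring \<Longrightarrow> (\<lambda>x. f x + g x) \<in> plane_ring"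
| mult: "f \<in> plane_ring \<Longrightarrow> g \<in> plane_ring \<Longrightarrow> (\<lambda>x. f x * g x) \<in> plane_ring"

lemma plane_ring_const: "(\<lambda>x. c) \<in> plane_ring"
  using plane_ring.radial[OF exp_ring.const] .

lemma plane_ring_recip: "(\<lambda>x. recip (radial x)) \<in> plane_ring"
  using plane_ring.radial[OF exp_ring.recip] .

lemma plane_ring_exp: "(\<lambda>x. exp (radial x)) \<in> plane_ring"
  using plane_ring.radial[OF exp_ring.exp] .

lemma plane_ring_q: "(\<lambda>x. q x) \<in> plane_ring"
  unfolding q_def by (intro plane_ring.mult plane_ring_exp plane_ring_recip)

lemmas plane_ring_intros =
  plane_ring.cx plane_ring.cy plane_ring.damping plane_ring.gauss
  plane_ring_const plane_ring_recip plane_ring_exp plane_ring_q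
  plane_ring.add plane_ring.mult plane_ring.mean plane_ring.radial

lemma plane_ring_partialsI:
  assumes "has_partials f (\<lambda>x. damping x * f1 x) (\<lambda>x. damping x * f2 x)"
    and "f1 \<in> plane_ring" "f2 \<in> plane_ring"
  shows "\<exists>f1\<in>plane_ring. \<exists>f2\<in>plane_ring. has_partials f (\<lambda>x. damping x * f1 x) (\<lambda>x. damping x * f2 x)"
  using assms by blast

text \<open>Every generator has partials with a factor \<open>damping\<close>, and the sum and
  product rules keep that factor. Since \<open>damping\<close> lies in the ring, the statement can
  be iterated.\<close>

lemma plane_ring_partials:
  "f \<in> plane_ring \<Longrightarrow>
    \<exists>f1\<in>plane_ring. \<exists>f2\<in>plane_ring. has_partials f (\<lambda>x. damping x * f1 x) (\<lambda>x. damping x * f2 x)"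
proof (induction rule: plane_ring.induct)
  case cx
  show ?case
    by (rule plane_ring_partialsI[OF has_partials_cx]) (intro plane_ring_intros)+
next
  case cy
  show ?case
    by (rule plane_ring_partialsI[OF has_partials_cy]) (intro plane_ring_intros)+
next
  case damping
  show ?case
    by (rule plane_ring_partialsI[OF has_partials_damping]) (intro plane_ring_intros)+
next
  case gauss
  have "((\<lambda>t::real. exp (- t\<^sup>2)) has_real_derivative exp (- t\<^sup>2) * (- 2 * t)) (at t)" for t
    by (auto intro!: derivative_eq_intros)
  from has_partials_compose[OF has_partials_cx this]
  have "has_partials (\<lambda>x. exp (- (cx x)\<^sup>2))
    (\<lambda>x. damping x * (exp (- (cx x)\<^sup>2) * ((- 2) * cx x) * (1 + - 1 * cx x * cx x * q x)))
    (\<lambda>x. damping x * (exp (- (cx x)\<^sup>2) * ((- 2) * cx x) * (- 1 * cx x * cy x * q x)))"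
    by (rule has_partials_cong) auto
  then show ?case
    by (rule plane_ring_partialsI) (intro plane_ring_intros)+
next
  case (radial \<phi>)
  then obtain \<phi>' where d: "\<phi>' \<in> exp_ring" "\<And>k. (\<phi> has_real_derivative \<phi>' k) (at k)"
    using exp_ring_DERIV by blast
  from has_partials_compose[OF has_partials_radial d(2)]
  have "has_partials (\<lambda>x. \<phi> (radial x))
    (\<lambda>x. damping x * (\<phi>' (radial x) * (2 * cx x * recip (radial x))))
    (\<lambda>x. damping x * (\<phi>' (radial x) * (2 * cy x * recip (radial x))))"
    by (rule has_partials_cong) auto
  then show ?case
    by (rule plane_ring_partialsI) (intro plane_ring_intros d)+
next
  case (mean \<phi> n)
  then obtain \<phi>' where d: "\<phi>' \<in> exp_ring" "\<And>k. (\<phi> has_real_derivative \<phi>' k) (at k)"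
    using exp_ring_DERIV by blast
  \<comment> \<open>The Y-derivative raises the weight by 2, so the ring has to contain the means of
    every weight.\<close>
  let ?m = "\<lambda>x. 2 * cx x * segment_mean n \<phi>' (cx x) (cy x)"
  let ?m' = "\<lambda>x. 2 * cy x * segment_mean (n+2) \<phi>' (cx x) (cy x)"
  from has_partials_segment_mean[OF d(2) exp_ring_continuous[OF d(1)] has_partials_cx has_partials_cy, of n]
  have "has_partials (\<lambda>x. segment_mean n \<phi> (cx x) (cy x))
    (\<lambda>x. damping x * (?m x * (1 + - 1 * cx x * cx x * q x) + ?m' x * (- 1 * cx x * cy x * q x)))
    (\<lambda>x. damping x * (?m x * (- 1 * cx x * cy x * q x) + ?m' x * (1 + - 1 * cy x * cy x * q x)))"
    by (rule has_partials_cong) (auto simp: algebra_simps)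
  then show ?case
    by (rule plane_ring_partialsI) (intro plane_ring_intros d)+
next
  case (add f g)
  then obtain f1 f2 g1 g2 where *: "f1 \<in> plane_ring" "f2 \<in> plane_ring" "g1 \<in> plane_ring" "g2 \<in> plane_ring"
    and p: "has_partials f (\<lambda>x. damping x * f1 x) (\<lambda>x. damping x * f2 x)"
      "has_partials g (\<lambda>x. damping x * g1 x) (\<lambda>x. damping x * g2 x)"
    by blast
  have "has_partials (\<lambda>x. f x + g x) (\<lambda>x. damping x * (f1 x + g1 x)) (\<lambda>x. damping x * (f2 x + g2 x))"
    using has_partials_add[OF p] by (rule has_partials_cong) (auto simp: algebra_simps)
  then show ?case
    by (rule plane_ring_partialsI) (intro plane_ring_intros *)+
next
  case (mult f g)
  then obtain f1 f2 g1 g2 where *: "f1 \<in> plane_ring" "f2 \<in> plane_ring" "g1 \<in> plane_ring" "g2 \<in> plane_ring"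
    and p: "has_partials f (\<lambda>x. damping x * f1 x) (\<lambda>x. damping x * f2 x)"
      "has_partials g (\<lambda>x. damping x * g1 x) (\<lambda>x. damping x * g2 x)"
    by blast
  have "has_partials (\<lambda>x. f x * g x) (\<lambda>x. damping x * (f1 x * g x + f x * g1 x)) (\<lambda>x. damping x * (f2 x * g x + f x * g2 x))"
    using has_partials_mult[OF p] by (rule has_partials_cong) (auto simp: algebra_simps)
  then show ?case
    by (rule plane_ring_partialsI) (intro plane_ring_intros * mult.hyps)+
qed

text \<open>The chain |a| \<le> 1 + a^2 \<le> 1 + k \<le> e^k; it bounds X and Y by e^K.\<close>

lemma abs_le_exp_of_square_le:
  fixes a k :: real
  assumes "a\<^sup>2 \<le> k"
  shows "\<bar>a\<bar> \<le> exp k"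
proof -
  have "0 \<le> (\<bar>a\<bar> - 1 / 2)\<^sup>2" by simp
  then have "\<bar>a\<bar> \<le> 1 + a\<^sup>2" by (simp add: power2_eq_square algebra_simps)
  then show ?thesis using assms exp_ge_add_one_self[of k] by linarith
qed

lemma plane_ring_dominated: "f \<in> plane_ring \<Longrightarrow> exp_dominated radial f"
proof (induction rule: plane_ring.induct)
  case cx
  show ?case
    using radial_eq by (intro exp_dominatedI[of _ 1 1]) (auto intro!: abs_le_exp_of_square_le simp flip: radial_eq)
next
  case cy
  show ?case
    using radial_eq by (intro exp_dominatedI[of _ 1 1]) (auto intro!: abs_le_exp_of_square_le simp flip: radial_eq)
next
  case damping
  show ?case
    using radial_nonneg by (intro exp_dominatedI[of _ 1 0]) (auto simp: damping_def)
next
  case gauss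
  show ?case
    by (intro exp_dominatedI[of _ 1 0]) auto
next
  case (radial \<phi>)
  then obtain C n where "\<And>k. \<bar>\<phi> \<bar>k\<bar>\<bar> \<le> C * exp (real n * \<bar>k\<bar>)"
    using exp_ring_dominated unfolding exp_dominated_def by blast
  from this[of "radial _"] show ?case
    using radial_nonneg by (intro exp_dominatedI[of _ C n]) auto
next
  case (mean \<phi> m)
  then obtain C n where *: "\<And>k. \<bar>\<phi> \<bar>k\<bar>\<bar> \<le> C * exp (real n * \<bar>k\<bar>)"
    using exp_ring_dominated unfolding exp_dominated_def by blast
  have C: "0 \<le> C" using *[of 0] by simp
  show ?case
  \<comment> \<open>The mean evaluates \<phi> only between X^2 and K, where its exponential bound is
    largest at K.\<close>
  proof (rule exp_dominatedI, rule segment_mean_bound[OF exp_ring_continuous[OF mean]])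
    fix x k assume k': "(cx x)\<^sup>2 \<le> k" "k \<le> (cx x)\<^sup>2 + (cy x)\<^sup>2"
    then have k: "0 \<le> k" "k \<le> (cx x)\<^sup>2 + (cy x)\<^sup>2"
      using order_trans[OF zero_le_power2 k'(1)] by auto
    have "C * exp (real n * k) \<le> C * exp (real n * radial x)"
      using k C by (auto simp: radial_eq intro!: mult_left_mono)
    then show "\<bar>\<phi> k\<bar> \<le> C * exp (real n * radial x)"
      using *[of k] k by simp
  qed
qed (auto intro: exp_dominated_add exp_dominated_mult radial_nonneg)

text \<open>The exponent -(e^k - 1)/2 + n k is at most n^2: the Taylor bound gives (e^k - 1)/2 \<ge>
  k/2 + k^2/4, and completing the square gives n k \<le> k^2/4 + n^2.\<close>

lemma plane_ring_damping_bounded: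
  assumes "f \<in> plane_ring"
  obtains B where "\<And>x. \<bar>damping x * f x\<bar> \<le> B"
proof -
  obtain C n where *: "\<And>x. \<bar>f x\<bar> \<le> C * exp (real n * radial x)"
    using plane_ring_dominated[OF assms] unfolding exp_dominated_def by blast
  have "\<bar>damping x * f x\<bar> \<le> \<bar>C\<bar> * exp ((real n)\<^sup>2)" for x
  proof -
    define k where "k = radial x"
    have k: "0 \<le> k" by (simp add: k_def radial_nonneg)
    have "0 \<le> (k / 2 - real n)\<^sup>2" by simp
    then have "real n * k \<le> k\<^sup>2 / 4 + (real n)\<^sup>2"
      by (simp add: power2_eq_square field_simps)
    moreover have "1 + k + k\<^sup>2 / 2 \<le> exp k"
      using exp_lower_Taylor_quadratic[OF k] by simp
    ultimately have "- (exp k - 1) / 2 + real n * k \<le> (real n)\<^sup>2"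
      using k by argo
    then have e: "damping x * exp (real n * radial x) \<le> exp ((real n)\<^sup>2)"
      by (simp add: damping_def k_def flip: exp_add)
    have "\<bar>damping x * f x\<bar> \<le> damping x * (\<bar>C\<bar> * exp (real n * radial x))"
      using *[of x] damping_pos[of x]
      by (auto simp: abs_mult intro!: mult_left_mono intro: order_trans mult_right_mono)
    also have "\<dots> = \<bar>C\<bar> * (damping x * exp (real n * radial x))" by simp
    also have "\<dots> \<le> \<bar>C\<bar> * exp ((real n)\<^sup>2)" by (rule mult_left_mono[OF e]) simp
    finally show ?thesis .
  qed
  then show ?thesis by (rule that)
qed

lemma plane_ring_C_diff: "f \<in> plane_ring \<Longrightarrow> C_diff k f"
proof (induction k arbitrary: f)
  case 0
  then show ?case
    using plane_ring_partials has_partials_imp_continuous by fastforce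
next
  case (Suc k)
  obtain f1 f2 where f: "f1 \<in> plane_ring" "f2 \<in> plane_ring"
    and p: "has_partials f (\<lambda>x. damping x * f1 x) (\<lambda>x. damping x * f2 x)"
    using plane_ring_partials[OF Suc.prems] by blast
  have "C_diff k (partial i f)" for i
  proof -
    have "(\<lambda>x. damping x * f1 x) \<in> plane_ring" "(\<lambda>x. damping x * f2 x) \<in> plane_ring"
      by (intro plane_ring_intros f)+
    then have "partial i f \<in> plane_ring"
      using exhaust_2[of i] has_partials_partial[OF p] by auto
    then show ?thesis by (rule Suc.IH)
  qed
  then show ?case
    using has_partials_imp_differentiable[OF p] by simp
qed

lemma vector_field_has_derivative:
  assumes "has_partials f f1 f2" "has_partials g g1 g2"
  shows "((\<lambda>x. vector [f x, g x] :: real^2) has_derivative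
    (\<lambda>h. vector [f1 x * h$1 + f2 x * h$2, g1 x * h$1 + g2 x * h$2])) (at x)"
proof -
  \<comment> \<open>Expansion in the standard basis reduces the vector-valued derivative to the
    scalar ones.\<close>
  have v: "(vector [a, b] :: real^2) = a *\<^sub>R axis 1 1 + b *\<^sub>R axis 2 1" for a b
    by (simp add: vec_eq_iff forall_2 axis_def)
  show ?thesis
    unfolding v using assms unfolding has_partials_def
    by (intro has_derivative_add has_derivative_scaleR_left) auto
qed

lemma vector_field_partial:
  assumes "has_partials f f1 f2" "has_partials g g1 g2"
  shows "partial 1 (\<lambda>x. vector [f x, g x] :: real^2) = (\<lambda>x. vector [f1 x, g1 x])"
    and "partial 2 (\<lambda>x. vector [f x, g x] :: real^2) = (\<lambda>x. vector [f2 x, g2 x])"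
  using frechet_derivative_at[OF vector_field_has_derivative[OF assms], symmetric]
  by (simp_all add: partial_def fun_eq_iff axis_def)

section \<open>Vector fields with bounded derivatives\<close>

text \<open>A class of bounded fields closed under \<open>partial\<close>. Membership alone
  therefore yields smoothness and bounds for all derivatives.\<close>

definition damped_fields :: "(real^2 \<Rightarrow> real^2) set" where
  "damped_fields = {(\<lambda>x. vector [damping x * f x, damping x * g x]) | f g. f \<in> plane_ring \<and> g \<in> plane_ring}"

lemma damped_fields_step:
  assumes "b \<in> damped_fields"
  shows "b differentiable (at x)" "partial i b \<in> damped_fields"
proof -
  obtain f g where fg: "f \<in> plane_ring" "g \<in> plane_ring"
    and b: "b = (\<lambda>x. vector [damping x * f x, damping x * g x])"
    using assms unfolding damped_fields_def by blast
  have fg': "(\<lambda>x. damping x * f x) \<in> plane_ring" "(\<lambda>x. damping x * g x) \<in> plane_ring"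
    by (intro plane_ring_intros fg)+
  obtain f1 f2 where f: "f1 \<in> plane_ring" "f2 \<in> plane_ring"
    "has_partials (\<lambda>x. damping x * f x) (\<lambda>x. damping x * f1 x) (\<lambda>x. damping x * f2 x)"
    using plane_ring_partials[OF fg'(1)] by blast
  obtain g1 g2 where g: "g1 \<in> plane_ring" "g2 \<in> plane_ring"
    "has_partials (\<lambda>x. damping x * g x) (\<lambda>x. damping x * g1 x) (\<lambda>x. damping x * g2 x)"
    using plane_ring_partials[OF fg'(2)] by blast
  show "b differentiable (at x)"
    unfolding b differentiable_def using vector_field_has_derivative[OF f(3) g(3)] by blast
  show "partial i b \<in> damped_fields"
    using exhaust_2[of i] f(1,2) g(1,2) vector_field_partial[OF f(3) g(3)]
    unfolding b damped_fields_def by auto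
qed

lemma damped_fields_bounded:
  assumes "b \<in> damped_fields"
  shows "bounded (range b)"
proof -
  obtain f g where fg: "f \<in> plane_ring" "g \<in> plane_ring"
    and b: "b = (\<lambda>x. vector [damping x * f x, damping x * g x])"
    using assms unfolding damped_fields_def by blast
  obtain A where A: "\<And>x. \<bar>damping x * f x\<bar> \<le> A"
    using plane_ring_damping_bounded[OF fg(1)] by blast
  obtain B where B: "\<And>x. \<bar>damping x * g x\<bar> \<le> B"
    using plane_ring_damping_bounded[OF fg(2)] by blast
  have "norm (b x) \<le> A + B" for x
    using norm_le_l1_cart[of "b x"] A[of x] B[of x] unfolding b by (simp add: sum_2)
  then show ?thesis
    by (auto simp: bounded_iff)
qed

lemma damped_fields_smooth: "b \<in> damped_fields \<Longrightarrow> smooth b"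
proof -
  have "C_diff k b" if "b \<in> damped_fields" for k and b :: "real^2 \<Rightarrow> real^2"
    using that
  proof (induction k arbitrary: b)
    case 0
    then show ?case
      using damped_fields_step(1) differentiable_imp_continuous_within continuous_at_imp_continuous_on
      by (metis C_diff.simps(1))
  next
    case (Suc k)
    then show ?case
      using damped_fields_step by simp
  qed
  then show "b \<in> damped_fields \<Longrightarrow> smooth b"
    by (simp add: smooth_def)
qed

lemma damped_fields_all_derivs_bounded:
  assumes "b \<in> damped_fields"
  shows "all_derivs_bounded b"
proof -
  have "foldr partial is b \<in> damped_fields" for "is"
    using assms by (induction "is") (auto intro: damped_fields_step(2))
  then show ?thesis
    unfolding all_derivs_bounded_def using damped_fields_bounded by blast
qed

section \<open>The stream function and its symmetric second derivatives\<close>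

text \<open>
  With \<open>k = X\<^sup>2 + Y\<^sup>2\<close>, \<open>E = 1 + k e\<^sup>k\<close> and \<open>S = 1 / E\<close>, the equation for \<open>u = g(X)\<close> reads
  \<open>\<partial>H/\<partial>Y = X (- 2 E + 2 S' + (2 X\<^sup>2 - 1) (E - S) / k)\<close>.  Splitting off the exact derivative of
  \<open>- X Y e\<^sup>k\<close> leaves \<open>X (drift_core0 k + X\<^sup>2 drift_core1 k)\<close>.
\<close>

definition drift_core0 :: "real \<Rightarrow> real" where
  "drift_core0 k = - 2 + (- 2) * ((1 + k) * exp k * (recip k * recip k)) + (- 1) * (exp k * recip k)"

definition drift_core1 :: "real \<Rightarrow> real" where
  "drift_core1 k = 2 * (exp k * recip k)"

lemma drift_core_ring: "drift_core0 \<in> exp_ring" "drift_core1 \<in> exp_ring"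
  unfolding drift_core0_def[abs_def] drift_core1_def[abs_def] by (intro exp_ring.intros)+

text \<open>The factor Y turns each mean into an integral from the axis Y = 0. The factor X^2 stays
  outside its mean because X is constant along the segment.\<close>

definition stream :: "real^2 \<Rightarrow> real" where
  "stream x = cx x * cy x * (segment_mean 0 drift_core0 (cx x) (cy x)
     + cx x * cx x * segment_mean 0 drift_core1 (cx x) (cy x) + (- 1) * exp (radial x))"

lemma stream_ring: "stream \<in> plane_ring"
  unfolding stream_def[abs_def] by (intro plane_ring_intros drift_core_ring)+

text \<open>\<open>squeeze\<close> solves an autonomous equation with right-hand side
  \<psi>(\<open>squeeze\<close>), so its second derivative is again an explicit function of
  \<open>squeeze\<close>.\<close>

lemma has_symmetric_partials_radial: "has_symmetric_partials radial"
proof -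
  define \<psi> where "\<psi> = (\<lambda>k. exp (- (exp k - 1)) * recip k)"
  define \<psi>' where "\<psi>' = (\<lambda>k. exp (- (exp k - 1)) * (- exp k) * recip k
      + exp (- (exp k - 1)) * (- (1 + k) * exp k * (recip k * recip k)))"
  have 1: "(\<psi> has_real_derivative \<psi>' k) (at k)" for k
    unfolding \<psi>_def \<psi>'_def by (rule derivative_eq_intros recip_DERIV refl)+ (simp add: algebra_simps)
  have 2: "(squeeze has_real_derivative \<psi> (squeeze r)) (at r)" for r
    unfolding \<psi>_def by (rule squeeze_DERIV)
  have 3: "((\<lambda>r. \<psi> (squeeze r)) has_real_derivative \<psi>' (squeeze r) * \<psi> (squeeze r)) (at r)" for r
    by (rule DERIV_chain2[OF 1 2])
  have "has_symmetric_partials (\<lambda>x. x$1 * x$1 + x$2 * x$2)"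
    by (intro has_symmetric_partials_add has_symmetric_partials_mult has_symmetric_partials_nth)
  from has_symmetric_partials_compose[OF this 2 3] show ?thesis
    by (simp add: radial_def[abs_def] power2_eq_square)
qed

lemma has_symmetric_partials_damping: "has_symmetric_partials damping"
proof -
  have 1: "((\<lambda>k::real. exp (- (exp k - 1) / 2)) has_real_derivative exp (- (exp k - 1) / 2) * (- exp k / 2)) (at k)" for k
    by (auto intro!: derivative_eq_intros)
  have 2: "((\<lambda>k::real. exp (- (exp k - 1) / 2) * (- exp k / 2)) has_real_derivative
     exp (- (exp k - 1) / 2) * (- exp k / 2) * (- exp k / 2) + exp (- (exp k - 1) / 2) * (- exp k / 2)) (at k)" for k
    by (rule DERIV_cong[OF DERIV_mult[OF 1 DERIV_cdivide[OF DERIV_minus[OF DERIV_exp]]]]) (simp add: algebra_simps)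
  show ?thesis
    unfolding damping_def[abs_def]
    by (rule has_symmetric_partials_compose[OF has_symmetric_partials_radial 1 2])
qed

lemma has_symmetric_partials_cx: "has_symmetric_partials cx"
  and has_symmetric_partials_cy: "has_symmetric_partials cy"
  unfolding cx_def[abs_def] cy_def[abs_def]
  by (intro has_symmetric_partials_mult has_symmetric_partials_nth has_symmetric_partials_damping)+

lemma has_symmetric_partials_mean:
  assumes "\<phi> \<in> exp_ring"
  shows "has_symmetric_partials (\<lambda>x. segment_mean n \<phi> (cx x) (cy x))"
proof -
  obtain \<phi>' where 1: "\<phi>' \<in> exp_ring" "\<And>k. (\<phi> has_real_derivative \<phi>' k) (at k)"
    using exp_ring_DERIV[OF assms] by blast
  obtain \<phi>'' where 2: "\<phi>'' \<in> exp_ring" "\<And>k. (\<phi>' has_real_derivative \<phi>'' k) (at k)"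
    using exp_ring_DERIV[OF 1(1)] by blast
  show ?thesis
    by (rule has_symmetric_partials_segment_mean[OF 1(2) 2(2) exp_ring_continuous[OF 2(1)]
        has_symmetric_partials_cx has_symmetric_partials_cy])
qed

lemma has_symmetric_partials_stream: "has_symmetric_partials stream"
  unfolding stream_def[abs_def]
  by (intro has_symmetric_partials_add has_symmetric_partials_mult has_symmetric_partials_const
      has_symmetric_partials_cx has_symmetric_partials_cy has_symmetric_partials_mean drift_core_ring
      has_symmetric_partials_compose[OF has_symmetric_partials_radial, of exp exp exp] DERIV_exp)

lemma divergence_perp_grad:
  assumes "has_symmetric_partials f"
  shows "divergence (perp_grad f) x = 0"
proof -
  obtain f1 f2 f11 f12 f22 where
    f: "has_partials f f1 f2" "has_partials f1 f11 f12" "has_partials f2 f12 f22"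
    using assms unfolding has_symmetric_partials_def by blast
  have "has_partials (\<lambda>x. - f1 x) (\<lambda>x. - f11 x) (\<lambda>x. - f12 x)"
    using has_partials_mult[OF has_partials_const[of "- 1"] f(2)] by (rule has_partials_cong) auto
  then show ?thesis
    by (simp add: divergence_def sum_2 perp_grad_def has_partials_partial[OF f(1)]
        has_partials_partial[OF f(3)] has_partials_partial)
qed

text \<open>\<open>A\<close> and \<open>B\<close> are the derivatives of H in X and in Y, combined
  by the chain rule. Only \<open>B\<close> is given explicitly, because \<open>A\<close> cancels
  when the gradient of H is paired with that of a function of X.\<close>

lemma stream_partials:
  obtains A B where
    "has_partials stream
      (\<lambda>x. damping x * (A x * (1 - cx x * cx x * q x) - B x * (cx x * cy x * q x)))
      (\<lambda>x. damping x * (B x * (1 - cy x * cy x * q x) - A x * (cx x * cy x * q x)))"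
    "\<And>x. B x = cx x * (drift_core0 (radial x) + (cx x)\<^sup>2 * drift_core1 (radial x)
       - exp (radial x) - 2 * (cy x)\<^sup>2 * exp (radial x))"
proof -
  obtain c0' where c0: "c0' \<in> exp_ring" "\<And>k. (drift_core0 has_real_derivative c0' k) (at k)"
    using exp_ring_DERIV[OF drift_core_ring(1)] by blast
  obtain c1' where c1: "c1' \<in> exp_ring" "\<And>k. (drift_core1 has_real_derivative c1' k) (at k)"
    using exp_ring_DERIV[OF drift_core_ring(2)] by blast
  note cont = exp_ring_continuous[OF c0(1)] exp_ring_continuous[OF c1(1)]
  define E where "E = (\<lambda>x. exp (radial x))"
  define m where "m = (\<lambda>x. segment_mean 0 drift_core0 (cx x) (cy x)
     + cx x * cx x * segment_mean 0 drift_core1 (cx x) (cy x) + (- 1) * E x)"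
  define A where "A = (\<lambda>x. cy x * m x + cx x * cy x * (2 * cx x * segment_mean 0 c0' (cx x) (cy x)
     + 2 * cx x * segment_mean 0 drift_core1 (cx x) (cy x)
     + cx x * cx x * (2 * cx x * segment_mean 0 c1' (cx x) (cy x)) - 2 * cx x * E x))"
  define B where "B = (\<lambda>x. cx x * m x + cx x * cy x * (2 * cy x * segment_mean 2 c0' (cx x) (cy x)
     + cx x * cx x * (2 * cy x * segment_mean 2 c1' (cx x) (cy x)) - 2 * cy x * E x))"
  \<comment> \<open>Replacing K by X^2 + Y^2 makes H an explicit function of X and Y alone.\<close>
  have stream: "stream = (\<lambda>x. cx x * cy x * (segment_mean 0 drift_core0 (cx x) (cy x)
     + cx x * cx x * segment_mean 0 drift_core1 (cx x) (cy x) + (- 1) * exp (cx x * cx x + cy x * cy x)))"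
    using radial_eq by (simp add: stream_def power2_eq_square fun_eq_iff)
  have EE: "exp (cx x * cx x + cy x * cy x) = E x" for x
    unfolding E_def using radial_eq[of x] by (simp add: power2_eq_square)
  obtain X1 X2 Y1 Y2 where cx: "has_partials cx X1 X2" and cy: "has_partials cy Y1 Y2"
    and X1: "\<And>x. X1 x = damping x * (1 - cx x * cx x * q x)"
    and X2: "\<And>x. X2 x = - (damping x * (cx x * cy x * q x))"
    and Y1: "\<And>x. Y1 x = - (damping x * (cx x * cy x * q x))"
    and Y2: "\<And>x. Y2 x = damping x * (1 - cy x * cy x * q x)"
    using has_partials_cx has_partials_cy by force
  note mean0 = has_partials_segment_mean[OF c0(2) cont(1) cx cy, of 0]
    and mean1 = has_partials_segment_mean[OF c1(2) cont(2) cx cy, of 0]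
    and square = has_partials_mult[OF cx cx]
  have chain: "has_partials (\<lambda>x. cx x * cy x * (segment_mean 0 drift_core0 (cx x) (cy x)
     + cx x * cx x * segment_mean 0 drift_core1 (cx x) (cy x) + (- 1) * exp (cx x * cx x + cy x * cy x)))
     (\<lambda>x. A x * X1 x + B x * Y1 x) (\<lambda>x. A x * X2 x + B x * Y2 x)"
    by (rule has_partials_cong[OF has_partials_mult[OF has_partials_mult[OF cx cy]
          has_partials_add[OF has_partials_add[OF mean0 has_partials_mult[OF square mean1]]
            has_partials_mult[OF has_partials_const[of "- 1"]
              has_partials_compose[OF has_partials_add[OF square has_partials_mult[OF cy cy]] DERIV_exp]]]]])
      (simp_all add: A_def B_def m_def EE algebra_simps flip: numeral_2_eq_2)
  have "has_partials stream
      (\<lambda>x. damping x * (A x * (1 - cx x * cx x * q x) - B x * (cx x * cy x * q x)))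
      (\<lambda>x. damping x * (B x * (1 - cy x * cy x * q x) - A x * (cx x * cy x * q x)))"
    unfolding stream by (rule has_partials_cong[OF chain]) (simp_all add: X1 Y1 X2 Y2 algebra_simps)
  moreover have "B x = cx x * (drift_core0 (radial x) + (cx x)\<^sup>2 * drift_core1 (radial x)
       - exp (radial x) - 2 * (cy x)\<^sup>2 * exp (radial x))" for x
    \<comment> \<open>Read from right to left, the identity expands each drift core at K into the
      means of weights 0 and 2 that occur in \<open>B\<close>.\<close>
    unfolding segment_mean_deriv_identity[OF c0(2) cont(1), of "cx x" "cy x", unfolded radial_eq, symmetric]
      segment_mean_deriv_identity[OF c1(2) cont(2), of "cx x" "cy x", unfolded radial_eq, symmetric]
    by (simp add: B_def m_def E_def algebra_simps power2_eq_square)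
  ultimately show ?thesis by (rule that)
qed

section \<open>Algebra behind the differential equation\<close>

definition q_deriv :: "real^2 \<Rightarrow> real" where
  "q_deriv x = q x - (1 + radial x) * (q x)\<^sup>2"

text \<open>\<open>q_deriv\<close> is dQ/dK, since Q = e^K \<open>recip\<close> K depends on the
  point through K only.\<close>

lemma has_partials_q:
  "has_partials q (\<lambda>x. q_deriv x * (damping x * (2 * cx x * recip (radial x))))
    (\<lambda>x. q_deriv x * (damping x * (2 * cy x * recip (radial x))))"
proof -
  have "((\<lambda>k. exp k * recip k) has_real_derivative
    exp k * recip k - (1 + k) * (exp k * recip k)\<^sup>2) (at k)" for k
    by (rule derivative_eq_intros recip_DERIV refl)+ (simp add: algebra_simps power2_eq_square)
  from has_partials_compose[OF has_partials_radial this]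
  show ?thesis
    by (rule has_partials_cong) (auto simp: q_def q_deriv_def)
qed

lemma radial_times_q: "radial x * q x = 1 - recip (radial x)"
  using recip_eq[of "radial x"] by (simp add: q_def algebra_simps)

text \<open>The equation for u after division by g'(X) and \<open>damping\<close> squared. On the
  left stands \<Delta>X - 2 X |\<nabla>X|^2, and on the right H_Y times s, the remaining factor of
  the Jacobian of (X, Y). The drift cores are chosen to make this hold.\<close>

lemma laplacian_identity:
  fixes X Y K s Q Q' T B c0 c1 :: real
  assumes K: "X\<^sup>2 + Y\<^sup>2 = K" and s: "s * (1 + K * T) = 1" and Q: "Q = T * s"
    and Q': "Q' = Q - (1 + K) * Q\<^sup>2"
    and B: "B = X * (c0 + X\<^sup>2 * c1 - T - 2 * Y\<^sup>2 * T)"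
    and c0: "c0 = - 2 - 2 * ((1 + K) * T * (s * s)) - T * s" and c1: "c1 = 2 * (T * s)"
  shows "- 4 * X * Q + 3 * X * K * Q\<^sup>2 - 2 * X * K * s * Q'
    - 2 * X * ((1 - X * X * Q)\<^sup>2 + (X * Y * Q)\<^sup>2) = B * s"
proof -
  have KQ: "K * Q = 1 - s" using s Q by (simp add: algebra_simps)
  have "X * X * Y * Y + X * X * X * X = X * X * K"
    using K by (simp add: power2_eq_square algebra_simps flip: K)
  then have 1: "(1 - X * X * Q)\<^sup>2 + (X * Y * Q)\<^sup>2 = 1 - 2 * X\<^sup>2 * Q + X\<^sup>2 * K * Q\<^sup>2"
    by (simp add: power2_eq_square algebra_simps flip: K)
  have "B * s = X * (- 2 * s - 2 * (1 + K) * Q * s * s - Q * s + 2 * X\<^sup>2 * Q * s - Q - 2 * (K - X\<^sup>2) * Q)"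
    unfolding B c0 c1 Q K[symmetric] by (simp add: algebra_simps power2_eq_square)
  also have "\<dots> = - 4 * X * Q + 3 * X * K * Q\<^sup>2 - 2 * X * K * s * Q'
    - 2 * X * (1 - 2 * X\<^sup>2 * Q + X\<^sup>2 * K * Q\<^sup>2)"
    unfolding Q' using KQ by algebra
  finally show ?thesis unfolding 1 by simp
qed

section \<open>The solution and the growth of the stream function\<close>

text \<open>Since exp(-t^2) \<le> 1/(1 + t^2), both g and arctan - g are nondecreasing. Increments
  of g are then dominated by those of arctan, whose range has length \<open>pi\<close>.\<close>

lemma bounded_gauss_primitive:
  obtains g :: "real \<Rightarrow> real" where
    "\<And>t. (g has_real_derivative exp (- t\<^sup>2)) (at t)" "\<And>s t. \<bar>g s - g t\<bar> \<le> pi"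
proof -
  have "\<exists>g. \<forall>t::real. -\<infinity> < ereal t \<longrightarrow> ereal t < \<infinity> \<longrightarrow> (g has_vector_derivative exp (- t\<^sup>2)) (at t)"
    by (rule einterval_antiderivative) (auto intro!: continuous_intros)
  then obtain g :: "real \<Rightarrow> real" where g: "\<And>t. (g has_real_derivative exp (- t\<^sup>2)) (at t)"
    by (auto simp: has_real_derivative_iff_has_vector_derivative)
  have mono: "mono g"
    by (rule monoI, rule DERIV_nonneg_imp_nondecreasing[where f = g]) (use g in \<open>auto intro!: exI\<close>)
  have mono': "mono (\<lambda>t. arctan t - g t)"
  proof (rule monoI, rule DERIV_nonneg_imp_nondecreasing[where f = "\<lambda>t. arctan t - g t"])
    fix t :: real
    have "exp (- t\<^sup>2) \<le> inverse (1 + t\<^sup>2)"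
      using exp_ge_add_one_self[of "t\<^sup>2"] by (simp add: exp_minus add_pos_nonneg)
    then show "\<exists>y. ((\<lambda>t. arctan t - g t) has_real_derivative y) (at t) \<and> 0 \<le> y"
      by (intro exI[of _ "inverse (1 + t\<^sup>2) - exp (- t\<^sup>2)"] conjI DERIV_diff DERIV_arctan g) simp
  qed
  have le: "\<bar>g s - g t\<bar> \<le> \<bar>arctan s - arctan t\<bar>" if "s \<le> t" for s t
    using monoD[OF mono that] monoD[OF mono' that] by linarith
  have "\<bar>g s - g t\<bar> \<le> pi" for s t
    using le[of s t] le[of t s] arctan_bounded[of s] arctan_bounded[of t]
    by (cases "s \<le> t") linarith+
  then show ?thesis by (rule that[OF g])
qed

text \<open>The left side is \<Delta>X - 2 X |\<nabla>X|^2 in the form given by the product rule,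
  with D for \<open>damping\<close>; the identity extracts the factor D^2.\<close>

lemma damped_laplacian_expansion:
  fixes X Y K s Q Q' D :: real
  assumes K: "K = X\<^sup>2 + Y\<^sup>2"
  shows "D * (- 1 * X * D * Q) * (1 - X * X * Q) -
     D *
     (2 * X * (D * (1 + - 1 * X * X * Q)) * Q +
      X * X * (Q' * (D * (2 * X * s)))) +
     (- (D * (- 1 * Y * D * Q)) * X * Y * Q -
      D *
      (D * (- 1 * X * Y * Q) * Y * Q + X * (D * (1 + - 1 * Y * Y * Q)) * Q +
       X * Y * (Q' * (D * (2 * Y * s))))) -
     2 * X * ((D * (1 + - 1 * X * X * Q))\<^sup>2 + (D * (- 1 * X * Y * Q))\<^sup>2) =
     D\<^sup>2 *
     (- 4 * X * Q + 3 * X * K * Q\<^sup>2 - 2 * X * K * s * Q' -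
      2 * X * ((1 - X * X * Q)\<^sup>2 + (X * Y * Q)\<^sup>2))"
  unfolding K by (simp add: power2_eq_square algebra_simps)
text \<open>The terms with A cancel, and those with B collect the Jacobian D^2 (1 - K Q) of the map
  to (X, Y).\<close>

lemma damped_bracket_expansion:
  fixes X Y K Q D A B G :: real
  assumes K: "K = X\<^sup>2 + Y\<^sup>2"
  shows "(D * (B * (1 - Y * Y * Q) - A * (X * Y * Q))) * (G * (D * (1 + - 1 * X * X * Q)))
        - (D * (A * (1 - X * X * Q) - B * (X * Y * Q))) * (G * (D * (- 1 * X * Y * Q))) = G * (D\<^sup>2 * (B * (1 - K * Q)))"
  unfolding K by (simp add: power2_eq_square algebra_simps)

text \<open>As g'' = -2 X g' at X, the Laplacian of g(X) is g'(X) (\<Delta>X - 2 X |\<nabla>X|^2).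
  The drift term is g'(X) H_Y times the Jacobian. Both equal G D^2 B s.\<close>

lemma stream_pde:
  assumes g: "\<And>t. (g has_real_derivative exp (- t\<^sup>2)) (at t)"
  shows "- laplacian (\<lambda>x. g (cx x)) x + perp_grad stream x \<bullet> grad (\<lambda>x. g (cx x)) x = 0"
proof -
  define G where "G = (\<lambda>x. exp (- (cx x)\<^sup>2))"
  define c1 where "c1 = (\<lambda>x. damping x * (1 + - 1 * cx x * cx x * q x))"
  define c2 where "c2 = (\<lambda>x. damping x * (- 1 * cx x * cy x * q x))"
  define d1 where "d1 = (\<lambda>x. damping x * (- 1 * cx x * damping x * q x))"
  define d2 where "d2 = (\<lambda>x. damping x * (- 1 * cy x * damping x * q x))"
  define q1 where "q1 = (\<lambda>x. q_deriv x * (damping x * (2 * cx x * recip (radial x))))"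
  define q2 where "q2 = (\<lambda>x. q_deriv x * (damping x * (2 * cy x * recip (radial x))))"
  define e2 where "e2 = (\<lambda>x. damping x * (1 + - 1 * cy x * cy x * q x))"
  have cx: "has_partials cx c1 c2" and cy: "has_partials cy c2 e2"
    and d: "has_partials damping d1 d2" and q: "has_partials q q1 q2"
    unfolding c1_def c2_def d1_def d2_def q1_def q2_def e2_def
    by (rule has_partials_cx has_partials_cy has_partials_damping has_partials_q)+
  define c11 where "c11 = (\<lambda>x. d1 x * (1 - cx x * cx x * q x)
    - damping x * (2 * cx x * c1 x * q x + cx x * cx x * q1 x))"
  define c22 where "c22 = (\<lambda>x. - d2 x * cx x * cy x * q x
    - damping x * (c2 x * cy x * q x + cx x * e2 x * q x + cx x * cy x * q2 x))"
  \<comment> \<open>The Laplacian involves only the pure second partials \<open>c11\<close> and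
    \<open>c22\<close>; the mixed ones are left to unification.\<close>
  have "\<exists>c12. has_partials c1 c11 c12"
    unfolding c1_def
    by (rule exI, rule has_partials_cong[OF has_partials_mult[OF d has_partials_add[OF has_partials_const[of 1]
          has_partials_mult[OF has_partials_mult[OF has_partials_mult[OF has_partials_const[of "- 1"] cx] cx] q]]] _ _ refl])
      (simp_all add: c11_def algebra_simps)
  then obtain c12 where c1: "has_partials c1 c11 c12" by blast
  have "\<exists>c21. has_partials c2 c21 c22"
    unfolding c2_def
    by (rule exI, rule has_partials_cong[OF has_partials_mult[OF d
          has_partials_mult[OF has_partials_mult[OF has_partials_mult[OF has_partials_const[of "- 1"] cx] cy] q]] _ refl])
      (simp_all add: c22_def algebra_simps)
  then obtain c21 where c2: "has_partials c2 c21 c22" by blast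
  have "((\<lambda>t::real. exp (- t\<^sup>2)) has_real_derivative exp (- t\<^sup>2) * (- 2 * t)) (at t)" for t
    by (auto intro!: derivative_eq_intros)
  from has_partials_compose[OF cx this]
  have G: "has_partials G (\<lambda>x. - 2 * G x * cx x * c1 x) (\<lambda>x. - 2 * G x * cx x * c2 x)"
    unfolding G_def by (rule has_partials_cong) auto
  have u: "has_partials (\<lambda>x. g (cx x)) (\<lambda>x. G x * c1 x) (\<lambda>x. G x * c2 x)"
    using has_partials_compose[OF cx g] by (simp add: G_def)
  have lap: "laplacian (\<lambda>x. g (cx x)) x
      = G x * (c11 x + c22 x - 2 * cx x * ((c1 x)\<^sup>2 + (c2 x)\<^sup>2))"
    unfolding laplacian_def sum_2 has_partials_partial[OF u]
      has_partials_partial[OF has_partials_mult[OF G c1]] has_partials_partial[OF has_partials_mult[OF G c2]]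
    by (simp add: algebra_simps power2_eq_square)
  obtain A B where AB: "has_partials stream
      (\<lambda>x. damping x * (A x * (1 - cx x * cx x * q x) - B x * (cx x * cy x * q x)))
      (\<lambda>x. damping x * (B x * (1 - cy x * cy x * q x) - A x * (cx x * cy x * q x)))"
    and B: "\<And>x. B x = cx x * (drift_core0 (radial x) + (cx x)\<^sup>2 * drift_core1 (radial x)
       - exp (radial x) - 2 * (cy x)\<^sup>2 * exp (radial x))"
    using stream_partials by blast
  define X Y K s Q Q' T D where "X = cx x" "Y = cy x" "K = radial x" "s = recip (radial x)"
    "Q = q x" "Q' = q_deriv x" "T = exp (radial x)" "D = damping x"
  note defs = this
  have K: "X\<^sup>2 + Y\<^sup>2 = K" using radial_eq by (simp add: defs)
  have s_eq: "recip K = s" by (simp add: defs)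
  have KQ: "K * Q = 1 - s" using radial_times_q by (simp add: defs)
  have id: "- 4 * X * Q + 3 * X * K * Q\<^sup>2 - 2 * X * K * s * Q'
      - 2 * X * ((1 - X * X * Q)\<^sup>2 + (X * Y * Q)\<^sup>2) = B x * s"
  proof (rule laplacian_identity[OF K])
    show "s * (1 + K * T) = 1" using recip_eq by (simp add: defs)
    show "Q = T * s" by (simp add: defs q_def)
    show "Q' = Q - (1 + K) * Q\<^sup>2" by (simp add: defs q_deriv_def)
    show "B x = X * (drift_core0 K + X\<^sup>2 * drift_core1 K - T - 2 * Y\<^sup>2 * T)"
      by (simp add: defs B)
    show "drift_core0 K = - 2 - 2 * ((1 + K) * T * (s * s)) - T * s"
      by (simp add: defs drift_core0_def)
    show "drift_core1 K = 2 * (T * s)"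
      by (simp add: defs drift_core1_def)
  qed
  have lap': "c11 x + c22 x - 2 * cx x * ((c1 x)\<^sup>2 + (c2 x)\<^sup>2) = D\<^sup>2 * (- 4 * X * Q + 3 * X * K * Q\<^sup>2
      - 2 * X * K * s * Q' - 2 * X * ((1 - X * X * Q)\<^sup>2 + (X * Y * Q)\<^sup>2))"
    unfolding c11_def c22_def c1_def c2_def d1_def d2_def q1_def q2_def e2_def defs[symmetric] s_eq
    by (rule damped_laplacian_expansion[OF K[symmetric]])
  have "perp_grad stream x \<bullet> grad (\<lambda>x. g (cx x)) x
      = (D * (B x * (1 - Y * Y * Q) - A x * (X * Y * Q))) * (G x * c1 x)
        - (D * (A x * (1 - X * X * Q) - B x * (X * Y * Q))) * (G x * c2 x)"
    by (simp add: perp_grad_def grad_def inner_vec_def sum_2 has_partials_partial[OF AB]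
        has_partials_partial[OF u] defs)
  also have "\<dots> = G x * (D\<^sup>2 * (B x * (1 - K * Q)))"
    unfolding c1_def c2_def defs[symmetric]
    by (rule damped_bracket_expansion[OF K[symmetric]])
  finally have "perp_grad stream x \<bullet> grad (\<lambda>x. g (cx x)) x = G x * (D\<^sup>2 * (B x * (1 - K * Q)))" .
  then show ?thesis
    unfolding lap lap' id KQ by simp
qed

section \<open>Growth of the stream function\<close>

lemma bounded_drift_cores:
  assumes "0 \<le> k"
  shows "\<bar>drift_core0 k\<bar> \<le> 7 * exp k" and "0 \<le> drift_core1 k" and "k * drift_core1 k \<le> 2"
proof -
  define s where "s = recip k"
  have s: "0 < s" "s \<le> 1" "s * (1 + k * exp k) = 1"
    using recip_pos recip_le_1 recip_eq assms by (auto simp: s_def)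
  \<comment> \<open>By the defining relation of s, the product k e^k s equals 1 - s.\<close>
  have ks: "k * (exp k * s) \<le> 1" and es: "exp k * s \<le> exp k"
    using s by (auto simp: algebra_simps)
  have "(1 + k) * exp k * (s * s) = ((exp k * s) + k * (exp k * s)) * s"
    by (simp add: algebra_simps)
  also have "\<dots> \<le> (exp k + 1) * 1"
    using ks es s assms by (intro mult_mono add_mono) auto
  finally have "(1 + k) * exp k * (s * s) \<le> exp k + 1" by simp
  moreover have "0 \<le> (1 + k) * exp k * (s * s)" "0 \<le> exp k * s" "1 \<le> exp k"
    using s assms by auto
  \<comment> \<open>The three terms add up to at most 2 + 2 (e^k + 1) + e^k, which is at most 7 e^k
    because e^k \<ge> 1.\<close>
  ultimately show "\<bar>drift_core0 k\<bar> \<le> 7 * exp k"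
    using es unfolding drift_core0_def s_def[symmetric] by linarith
  show "0 \<le> drift_core1 k"
    using s by (simp add: drift_core1_def flip: s_def)
  show "k * drift_core1 k \<le> 2"
    using ks by (simp add: drift_core1_def flip: s_def)
qed

text \<open>The factor |X Y| is at most K. The bracket is at most 7 e^K + 2 + e^K, hence at most 10
  e^K.\<close>

lemma stream_bound: "\<bar>stream x\<bar> \<le> 10 * radial x * exp (radial x)"
proof -
  define K where "K = radial x"
  have K: "(cx x)\<^sup>2 + (cy x)\<^sup>2 = K" "0 \<le> K"
    using radial_eq radial_nonneg by (auto simp: K_def)
  have e: "1 \<le> exp K" using K by simp
  have 0: "\<bar>segment_mean 0 drift_core0 (cx x) (cy x)\<bar> \<le> 7 * exp K"
  proof (rule segment_mean_bound[OF exp_ring_continuous[OF drift_core_ring(1)]])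
    fix k assume "(cx x)\<^sup>2 \<le> k" "k \<le> (cx x)\<^sup>2 + (cy x)\<^sup>2"
    then have "0 \<le> k" "k \<le> K" using K order_trans[OF zero_le_power2] by auto
    then show "\<bar>drift_core0 k\<bar> \<le> 7 * exp K"
      using bounded_drift_cores(1)[of k] exp_le_cancel_iff[of k K] by linarith
  qed
  \<comment> \<open>On the segment k \<ge> X^2, so X^2 times the core is at most k times the core,
    which is at most 2. Bounding the mean by 2/X^2 requires X to be nonzero.\<close>
  have 1: "\<bar>cx x * cx x * segment_mean 0 drift_core1 (cx x) (cy x)\<bar> \<le> 2"
  proof (cases "cx x = 0")
    case False
    then have pos: "0 < (cx x)\<^sup>2" by simp
    have "\<bar>segment_mean 0 drift_core1 (cx x) (cy x)\<bar> \<le> 2 / (cx x)\<^sup>2"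
    proof (rule segment_mean_bound[OF exp_ring_continuous[OF drift_core_ring(2)]])
      fix k assume k: "(cx x)\<^sup>2 \<le> k" "k \<le> (cx x)\<^sup>2 + (cy x)\<^sup>2"
      then have "0 \<le> k" using pos by linarith
      note * = bounded_drift_cores(2,3)[OF this]
      have "(cx x)\<^sup>2 * drift_core1 k \<le> 2"
        using mult_right_mono[OF k(1) *(1)] *(2) by linarith
      then show "\<bar>drift_core1 k\<bar> \<le> 2 / (cx x)\<^sup>2"
        using *(1) pos by (simp add: field_simps)
    qed
    then have "(cx x)\<^sup>2 * \<bar>segment_mean 0 drift_core1 (cx x) (cy x)\<bar> \<le> 2"
      using pos by (simp add: field_simps)
    then show ?thesis by (simp add: abs_mult power2_eq_square)
  qed simp
  have "0 \<le> (\<bar>cx x\<bar> - \<bar>cy x\<bar>)\<^sup>2" by simp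
  then have "2 * \<bar>cx x * cy x\<bar> \<le> K"
    by (simp add: power2_diff K(1)[symmetric] abs_mult)
  then have xy: "\<bar>cx x * cy x\<bar> \<le> K" using K by linarith
  have "\<bar>segment_mean 0 drift_core0 (cx x) (cy x)
     + cx x * cx x * segment_mean 0 drift_core1 (cx x) (cy x) + (- 1) * exp K\<bar> \<le> 10 * exp K"
    using 0 1 e by linarith
  then have "\<bar>stream x\<bar> \<le> K * (10 * exp K)"
    unfolding stream_def abs_mult[of "cx x * cy x"] K_def[symmetric]
    by (intro mult_mono xy K) auto
  then show ?thesis by (simp add: K_def)
qed

lemma stream_growth:
  "\<forall>\<^sub>F x in at_infinity. \<bar>stream x\<bar> \<le> 80 * ln (norm x) * ln (ln (norm x))"
  unfolding eventually_at_infinity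
proof (intro exI allI impI)
  \<comment> \<open>With t = ln |x| \<ge> 4, \<open>stretch 1\<close> is at most e^(2t), which
    forces k \<ge> 1, and also 4 t \<le> t^2.\<close>
  fix x :: "real^2" assume "exp 4 \<le> norm x"
  define N t k where "N = norm x" and "t = ln (norm x)" and "k = radial x"
  have N: "exp 4 \<le> N" "0 < N"
    using \<open>exp 4 \<le> norm x\<close> less_le_trans[OF exp_gt_zero] by (auto simp: N_def)
  have t: "4 \<le> t" "N = exp t"
    using N by (auto simp: t_def N_def[symmetric] ln_ge_iff)
  have "N\<^sup>2 = (x$1)\<^sup>2 + (x$2)\<^sup>2"
    by (simp add: N_def norm_vec_def L2_set_def sum_2)
  then have Nk: "exp (2 * t) = stretch k"
    by (simp add: t(2) k_def radial_def exp_double)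
  have "exp 1 - 1 \<le> (2 :: real)" using exp_le by simp
  then have "stretch 1 \<le> exp (2 * t)"
    unfolding stretch_def using t by simp
  then have k: "1 \<le> k"
    unfolding Nk using strict_mono_less_eq[OF stretch_strict_mono] by blast
  then have e: "2 \<le> exp k"
    using exp_ge_add_one_self[of k] by linarith
  have "exp (exp k - 1) \<le> exp (2 * t)"
    unfolding Nk stretch_def using k by simp
  \<comment> \<open>Here e^k - 1 \<le> 2 t, and e^k \<le> 2 (e^k - 1) because e^k \<ge> 2.\<close>
  then have ek: "exp k \<le> 4 * t" using e by simp
  have "exp k \<le> t * t"
    using ek t mult_right_mono[of 4 t t] by linarith
  then have "exp k \<le> exp (2 * ln t)"
    using t by (simp add: exp_double power2_eq_square)
  then have kt: "k \<le> 2 * ln t" by simp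
  \<comment> \<open>The constant 80 is 10 * 2 * 4, from k \<le> 2 ln t and e^k \<le> 4 t.\<close>
  have "10 * k * exp k \<le> 10 * (2 * ln t) * (4 * t)"
    using kt ek k t by (intro mult_mono) auto
  then show "\<bar>stream x\<bar> \<le> 80 * ln (norm x) * ln (ln (norm x))"
    using stream_bound[of x] by (simp add: k_def t_def algebra_simps)
qed

lemma stream_perp_grad_damped: "perp_grad stream \<in> damped_fields"
proof -
  obtain f1 f2 where f: "f1 \<in> plane_ring" "f2 \<in> plane_ring"
    and p: "has_partials stream (\<lambda>x. damping x * f1 x) (\<lambda>x. damping x * f2 x)"
    using plane_ring_partials[OF stream_ring] by blast
  have "(\<lambda>x. (- 1) * f1 x) \<in> plane_ring"
    by (intro plane_ring_intros f)
  moreover have "perp_grad stream = (\<lambda>x. vector [damping x * f2 x, damping x * ((- 1) * f1 x)])"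
    by (simp add: perp_grad_def has_partials_partial[OF p] fun_eq_iff)
  ultimately show ?thesis
    unfolding damped_fields_def using f(2) by (intro CollectI exI conjI)
qed

theorem theorem1p3:
  "\<exists>b :: real^2 \<Rightarrow> real^2.
     smooth b \<and> all_derivs_bounded b \<and> (\<forall>x. divergence b x = 0) \<and>
     (\<exists>H :: real^2 \<Rightarrow> real. stream_function H b \<and>
        (\<exists>C::real. \<forall>\<^sub>F x in at_infinity. \<bar>H x\<bar> \<le> C * ln (norm x) * ln (ln (norm x)))) \<and>
     (\<exists>u :: real^2 \<Rightarrow> real. classical_solution b u \<and> bounded (range u) \<and> \<not> u constant_on UNIV)"
proof -
  obtain g :: "real \<Rightarrow> real" where g: "\<And>t. (g has_real_derivative exp (- t\<^sup>2)) (at t)"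
    and gb: "\<And>s t. \<bar>g s - g t\<bar> \<le> pi"
    using bounded_gauss_primitive by blast
  define u where "u = (\<lambda>x. g (cx x))"
  \<comment> \<open>u is not among the generators of \<open>plane_ring\<close>, but its first
    partials lie in the ring, because g' at X is the Gaussian generator.\<close>
  have "C_diff 2 u"
  proof -
    obtain f1 f2 where f: "f1 \<in> plane_ring" "f2 \<in> plane_ring"
      and p: "has_partials cx (\<lambda>x. damping x * f1 x) (\<lambda>x. damping x * f2 x)"
      using plane_ring_partials[OF plane_ring.cx] by blast
    have u: "has_partials u (\<lambda>x. exp (- (cx x)\<^sup>2) * (damping x * f1 x)) (\<lambda>x. exp (- (cx x)\<^sup>2) * (damping x * f2 x))"
      unfolding u_def by (rule has_partials_compose[OF p g])
    have "(\<lambda>x. exp (- (cx x)\<^sup>2) * (damping x * f1 x)) \<in> plane_ring"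
      "(\<lambda>x. exp (- (cx x)\<^sup>2) * (damping x * f2 x)) \<in> plane_ring"
      by (intro plane_ring_intros f)+
    then have "C_diff 1 (partial i u)" for i
      using exhaust_2[of i] has_partials_partial[OF u] plane_ring_C_diff by metis
    then show ?thesis
      using has_partials_imp_differentiable[OF u] by (simp add: numeral_2_eq_2)
  qed
  then have "classical_solution (perp_grad stream) u"
    unfolding classical_solution_def u_def using stream_pde[OF g] by blast
  moreover have "bounded (range u)"
  proof -
    have "\<bar>u x\<bar> \<le> \<bar>g 0\<bar> + pi" for x
      using gb[of "cx x" 0] unfolding u_def by linarith
    then show ?thesis by (auto simp: bounded_iff)
  qed
  moreover have "\<not> u constant_on UNIV"
  proof
    assume "u constant_on UNIV"
    then have eq: "u (axis 1 1) = u 0"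
      unfolding constant_on_def by auto
    \<comment> \<open>g is strictly increasing, and X at the first basis vector is the value of
      \<open>damping\<close> there, which is positive.\<close>
    have "g 0 < g (cx (axis 1 1))"
      by (rule DERIV_pos_imp_increasing) (use g damping_pos in \<open>auto simp: cx_def axis_def intro!: exI\<close>)
    moreover have "cx 0 = 0" by (simp add: cx_def)
    ultimately show False using eq by (simp add: u_def)
  qed
  moreover have "stream_function stream (perp_grad stream)"
    using plane_ring_partials[OF stream_ring] has_partials_imp_differentiable
    unfolding stream_function_def by blast
  ultimately show ?thesis
    using damped_fields_smooth[OF stream_perp_grad_damped]
      damped_fields_all_derivs_bounded[OF stream_perp_grad_damped]
      divergence_perp_grad[OF has_symmetric_partials_stream] stream_growth
    by blast
qed

end
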